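(* Let $q=q(n)$ be a sequence of integers with $q(n)/n\to c$ for some constant $c\in(0,2)$ as $n\to\infty$. For each $n$ choose uniformly at random a bubble among all bubbles of size $q(n)$ found across all $(2n-1)!!$ linear chord diagrams with $n$ chords, and let $b_n$ be the number of bridges of the chosen bubble. Then $b_n$ is asymptotically normal as $n\to\infty$, with mean and variance $$\mathbb{E}[b_n]\sim\frac{q\,(2(n-1)-q)}{2(n-1)},\qquad \operatorname{Var}(b_n)\sim\frac{q^2\,(2(n-1)-q)^2}{4(n-1)^3},$$ that is, the ratio of the two sides tends to $1$ in each case and $(b_n-\mathbb{E}[b_n])/\sqrt{\operatorname{Var}(b_n)}$ converges in distribution to the standard normal law.
   Context: A linear chord diagram with $n$ chords is a perfect matching of the $2n$ vertices $1,2,\dots,2n$ arranged on a line; the matched pairs are called chords. A short chord is a chord joining two adjacent vertices $i,i+1$. A bubble is a non-empty set of consecutive vertices that is bounded on each side either by an end of the diagram or by a short chord, and which contains no vertex of a short chord (equivalently, a maximal run of consecutive vertices none of which belongs to a short chord). The size of a bubble is the number of vertices it contains. A bridge of a bubble is a chord joining a vertex of the bubble to a vertex outside the bubble. Bubbles are counted across all diagrams, so that $\Pr(b_n=b)=N_{q,b}(n)/\sum_{b'}N_{q,b'}(n)$, where $N_{q,b}(n)$ is the number of pairs (diagram with $n$ chords, bubble of size $q$ in it having exactly $b$ bridges). *)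

theory Defs
  imports "HOL-Probability.Probability" "HOL-Library.Disjoint_Sets"
begin

definition linear_chord_diagrams :: "nat \<Rightarrow> nat set set set" where
  "linear_chord_diagrams n = {D. partition_on {1..2 * n} D \<and> (\<forall>c\<in>D. card c = 2)}"

definition short_chord :: "nat set \<Rightarrow> bool" where
  "short_chord c \<longleftrightarrow> (\<exists>i. c = {i, i + 1})"

definition short_chord_vertices :: "nat set set \<Rightarrow> nat set" where
  "short_chord_vertices D = \<Union> {c \<in> D. short_chord c}"

definition is_bubble :: "nat \<Rightarrow> nat set set \<Rightarrow> nat set \<Rightarrow> bool" where
  "is_bubble n D B \<longleftrightarrow>
     (\<exists>l r. 1 \<le> l \<and> l \<le> r \<and> r \<le> 2 * n \<and> B = {l..r} \<and>
        B \<inter> short_chord_vertices D = {} \<and>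
        (l = 1 \<or> l - 1 \<in> short_chord_vertices D) \<and>
        (r = 2 * n \<or> r + 1 \<in> short_chord_vertices D))"

definition bridges :: "nat set set \<Rightarrow> nat set \<Rightarrow> nat set set" where
  "bridges D B = {c \<in> D. \<exists>x y. c = {x, y} \<and> x \<in> B \<and> y \<notin> B}"

definition sized_bubbles :: "nat \<Rightarrow> int \<Rightarrow> (nat set set \<times> nat set) set" where
  "sized_bubbles n q =
     {(D, B). D \<in> linear_chord_diagrams n \<and> is_bubble n D B \<and> int (card B) = q}"

definition bubble_count :: "int \<Rightarrow> nat \<Rightarrow> nat \<Rightarrow> nat" where
  "bubble_count q b n = card {(D, B) \<in> sized_bubbles n q. card (bridges D B) = b}"

text \<open>
  The law of the number of bridges of a uniformly random bubble of size \<open>q\<close>. If there is no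
  bubble of size \<open>q\<close> at all, then \<^const>\<open>pmf_of_set\<close>, and hence this law, is unspecified.
\<close>
definition bridge_pmf :: "nat \<Rightarrow> int \<Rightarrow> nat pmf" where
  "bridge_pmf n q = map_pmf (\<lambda>(D, B). card (bridges D B)) (pmf_of_set (sized_bubbles n q))"

lemma finite_sized_bubbles: "finite (sized_bubbles n q)"
proof (rule finite_subset)
  show "sized_bubbles n q \<subseteq> Pow (Pow {1..2 * n}) \<times> Pow {1..2 * n}"
    by (auto simp: sized_bubbles_def linear_chord_diagrams_def is_bubble_def partition_on_def)
qed auto

lemma card_bridges_le:
  assumes "(D, B) \<in> sized_bubbles n q"
  shows "card (bridges D B) \<le> 2 ^ (2 * n)"
proof -
  have "bridges D B \<subseteq> Pow {1..2 * n}"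
    using assms
    by (auto simp: sized_bubbles_def linear_chord_diagrams_def partition_on_def bridges_def)
  from card_mono[OF _ this] show ?thesis by (simp add: card_Pow)
qed

lemma pmf_bridge_pmf:
  assumes "sized_bubbles n q \<noteq> {}"
  shows "pmf (bridge_pmf n q) b =
    real (bubble_count q b n) / real (\<Sum>b' \<le> 2 ^ (2 * n). bubble_count q b' n)"
proof -
  let ?S = "sized_bubbles n q" and ?f = "\<lambda>(D, B). card (bridges D B)"
  have N: "bubble_count q b' n = card {x \<in> ?S. ?f x = b'}" for b'
    unfolding bubble_count_def by (rule arg_cong[where f = card]) auto
  have "?S = (\<Union>b' \<in> {..2 ^ (2 * n)}. {x \<in> ?S. ?f x = b'})"
    using card_bridges_le by fastforce
  then have "card ?S = card (\<Union>b' \<in> {..2 ^ (2 * n)}. {x \<in> ?S. ?f x = b'})"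
    by (rule arg_cong)
  also have "\<dots> = (\<Sum>b' \<le> 2 ^ (2 * n). card {x \<in> ?S. ?f x = b'})"
    by (rule card_UN_disjoint) (auto simp: finite_sized_bubbles)
  finally have S: "(\<Sum>b' \<le> 2 ^ (2 * n). bubble_count q b' n) = card ?S"
    by (simp add: N)
  have "?S \<inter> ?f -` {b} = {x \<in> ?S. ?f x = b}" by auto
  then show ?thesis
    unfolding S unfolding N bridge_pmf_def
    by (simp add: pmf_map measure_pmf_of_set assms finite_sized_bubbles)
qed

end

(* Take two non-adjacent bridge ends x, x' of a bubble, matched to y and y' outside, and replace the
   chords {x, y}, {x', y'} by {x, x'}, {y, y'}. Counting these switchings from both sides gives, for
   the number b of bridges of a random bubble of size q, with m = 2n - q,
     E[b^2 F(b)] = E[(q - b) (m - b) F(b + 2)] + O(n) sup |F|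
   for every function F: the adjacency constraints and the short chords at the ends of the bubble only
   affect the error term. As b^2 - (q - b) (m - b) = 2n (b - q m / 2n), this is a Stein identity.
   F = 1 and F(b) = b - q m / 2n yield mean and variance, and F(b) = exp(i s b / sigma) shows that
   the characteristic function of the normalised b nearly solves f' = - s f; Levy's continuity
   theorem concludes. *)

theory Submission
  imports Defs "HOL-Real_Asymp.Real_Asymp"
begin

section \<open>Switching bridges\<close>

text \<open>The obstacle is the conditioning: short chords in and around a bubble constrain the
  matching, so the law of b is awkward to write down. A switching keeps the interval
  \<open>B\<close> and changes only the matching; it compares bubbles of equal size, and of their
  total number only its being nonzero matters. Steps of 2 are forced, since a bridge has one end in
  \<open>B\<close> and any other chord meeting \<open>B\<close> has two, so b and q have the same
  parity. The increment F(b + 2) - F(b) is the source of the factor 2 in the variance 2 (q m)^2 /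
  N^3, where N = 2n; this is q^2 m^2 / (4 n^3). Accuracy: after division by N a bounded F leaves an
  error O(1), small against a standard deviation of order sqrt n. For F(b) = b - q m / N a supremum
  bound would give an error as large as the variance, so the estimates keep E |F|, which is O(sqrt
  n) there. At this precision n and n - 1 are interchangeable in the final formulas.\<close>

definition partner :: "nat set set \<Rightarrow> nat \<Rightarrow> nat" where
  "partner D v = (THE w. {v, w} \<in> D)"

lemma linear_chord_diagramsD:
  assumes "D \<in> linear_chord_diagrams n"
  shows "\<Union> D = {1..2 * n}" and "\<And>c. c \<in> D \<Longrightarrow> card c = 2"
    and "\<And>c d. c \<in> D \<Longrightarrow> d \<in> D \<Longrightarrow> c \<inter> d \<noteq> {} \<Longrightarrow> c = d"
  using assms by (auto simp: linear_chord_diagrams_def partition_on_def pairwise_def disjnt_def)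

lemma partner_eqI:
  assumes D: "D \<in> linear_chord_diagrams n" and vw: "{v, w} \<in> D"
  shows "partner D v = w"
  unfolding partner_def
proof (rule the_equality)
  fix u assume "{v, u} \<in> D"
  then have "{v, u} = {v, w}"
    using linear_chord_diagramsD(3)[OF D _ vw] by blast
  then show "u = w" by (metis doubleton_eq_iff)
qed (rule vw)

text \<open>A perfect matching is handled as a fixed-point-free involution of
  \<open>{1..2 * n}\<close>. Off this range no chord contains the vertex and the value of
  \<open>THE\<close> is arbitrary.\<close>

lemma partner:
  assumes D: "D \<in> linear_chord_diagrams n" and v: "v \<in> {1..2 * n}"
  shows "{v, partner D v} \<in> D" and "partner D v \<in> {1..2 * n}" and "partner D v \<noteq> v"
    and "partner D (partner D v) = v"
proof -
  from v linear_chord_diagramsD(1)[OF D] obtain c where c: "c \<in> D" "v \<in> c" by blast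
  with linear_chord_diagramsD(2)[OF D] have "card c = 2" by blast
  with c obtain w where w: "c = {v, w}" "v \<noteq> w"
    by (auto simp: card_2_iff)
  have p: "partner D v = w"
    using c(1) w(1) by (intro partner_eqI[OF D]) simp
  show "{v, partner D v} \<in> D" "partner D v \<noteq> v"
    using p w c(1) by simp_all
  show "partner D v \<in> {1..2 * n}"
    using linear_chord_diagramsD(1)[OF D] p w c(1) by blast
  show "partner D (partner D v) = v"
    using p w c(1) by (intro partner_eqI[OF D]) (simp add: insert_commute)
qed

lemma short_chord_vertices_iff:
  assumes D: "D \<in> linear_chord_diagrams n"
  shows "v \<in> short_chord_vertices D \<longleftrightarrow>
    v \<in> {1..2 * n} \<and> (partner D v = v + 1 \<or> v = partner D v + 1)"
proof
  assume "v \<in> short_chord_vertices D"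
  then obtain i where i: "{i, i + 1} \<in> D" "v \<in> {i, i + 1}"
    by (auto simp: short_chord_vertices_def short_chord_def)
  have "partner D i = i + 1" "partner D (i + 1) = i"
    using i(1) by (auto intro!: partner_eqI[OF D] simp: insert_commute)
  then show "v \<in> {1..2 * n} \<and> (partner D v = v + 1 \<or> v = partner D v + 1)"
    using i linear_chord_diagramsD(1)[OF D] by auto
next
  assume v: "v \<in> {1..2 * n} \<and> (partner D v = v + 1 \<or> v = partner D v + 1)"
  then have "{v, partner D v} \<in> D" using partner(1)[OF D] by blast
  moreover have "short_chord {v, partner D v}"
    using v unfolding short_chord_def by (metis insert_commute)
  ultimately show "v \<in> short_chord_vertices D"
    unfolding short_chord_vertices_def by blast
qed

text \<open>A switching is a relabelling by one transposition. In this form the partition property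
  comes from an injective image, the new partner map is a conjugate of the old one, and the move is
  its own inverse.\<close>

lemma relabel:
  fixes x y n :: nat and D :: "nat set set"
  defines "t \<equiv> Transposition.transpose x y"
  assumes D: "D \<in> linear_chord_diagrams n" and xy: "x \<in> {1..2 * n}" "y \<in> {1..2 * n}"
  shows relabel_diagram: "(`) t ` D \<in> linear_chord_diagrams n"
    and partner_relabel: "v \<in> {1..2 * n} \<Longrightarrow> partner ((`) t ` D) v = t (partner D (t v))"
proof -
  have inj: "inj_on t A" for A unfolding t_def by simp
  have tA: "t ` {1..2 * n} = {1..2 * n}"
    unfolding t_def using xy by (simp add: transpose_image_eq)
  have D': "partition_on {1..2 * n} D" "\<forall>c\<in>D. card c = 2"
    using D by (auto simp: linear_chord_diagrams_def)
  have "partition_on {1..2 * n} ((`) t ` D - {{}})"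
    using partition_on_inj_image[OF D'(1) inj] unfolding tA .
  moreover have "(`) t ` D - {{}} = (`) t ` D"
    using D' by (auto simp: partition_on_def)
  ultimately show *: "(`) t ` D \<in> linear_chord_diagrams n"
    using D'(2) by (simp add: linear_chord_diagrams_def card_image inj)
  show "partner ((`) t ` D) v = t (partner D (t v))" if v: "v \<in> {1..2 * n}"
  proof (rule partner_eqI[OF *])
    have "t v \<in> {1..2 * n}" using v tA by blast
    then have "{t v, partner D (t v)} \<in> D" by (rule partner(1)[OF D])
    then have "t ` {t v, partner D (t v)} \<in> (`) t ` D" by (rule imageI)
    then show "{v, t (partner D (t v))} \<in> (`) t ` D"
      by (simp add: t_def)
  qed
qed

lemma relabel_relabel:
  "(`) (Transposition.transpose x y) ` (`) (Transposition.transpose x y) ` D = D"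
  by (simp add: image_image)

text \<open>The vertices of the short chords bounding a bubble; at an end of the diagram the formula yields
  numbers outside \<open>{1..2 * n}\<close> instead.\<close>

definition flank :: "nat set \<Rightarrow> nat set" where
  "flank B = {Min B - 2, Min B - 1, Max B + 1, Max B + 2}"

lemma is_bubble_interval:
  assumes "is_bubble n D B"
  obtains l r where "1 \<le> l" "l \<le> r" "r \<le> 2 * n" "B = {l..r}" "Min B = l" "Max B = r"
    "B \<inter> short_chord_vertices D = {}"
    "l = 1 \<or> l - 1 \<in> short_chord_vertices D" "r = 2 * n \<or> r + 1 \<in> short_chord_vertices D"
proof -
  from assms obtain l r where lr: "1 \<le> l" "l \<le> r" "r \<le> 2 * n" "B = {l..r}"
    "B \<inter> short_chord_vertices D = {}"
    "l = 1 \<or> l - 1 \<in> short_chord_vertices D" "r = 2 * n \<or> r + 1 \<in> short_chord_vertices D"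
    unfolding is_bubble_def by blast
  moreover have "Min B = l" "Max B = r" unfolding lr(4) using lr(2)
    by (auto intro!: Min_eqI Max_eqI)
  ultimately show thesis by (intro that)
qed

lemma is_bubble_subset: "is_bubble n D B \<Longrightarrow> B \<subseteq> {1..2 * n}"
  by (auto simp: is_bubble_def)

text \<open>The vertex next to \<open>B\<close> on either side lies on a short chord unless the
  diagram ends there. That chord cannot lead into \<open>B\<close>, which has no vertex of a short
  chord, so it leads one step further out and stays within the flank.\<close>

lemma flank_partner:
  assumes D: "D \<in> linear_chord_diagrams n" and B: "is_bubble n D B"
    and v: "v \<in> flank B" "v \<in> {1..2 * n}"
  shows "v \<notin> B" "partner D v \<in> flank B" "partner D v \<notin> B"
proof -
  from B obtain l r where lr: "1 \<le> l" "l \<le> r" "r \<le> 2 * n" "B = {l..r}" "Min B = l" "Max B = r"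
    "B \<inter> short_chord_vertices D = {}"
    "l = 1 \<or> l - 1 \<in> short_chord_vertices D" "r = 2 * n \<or> r + 1 \<in> short_chord_vertices D"
    by (rule is_bubble_interval)
  have l: "l \<notin> short_chord_vertices D" and r: "r \<notin> short_chord_vertices D"
    using lr by auto
  have L: "l \<ge> 3 \<and> partner D (l - 1) = l - 2 \<and> partner D (l - 2) = l - 1" if "l \<noteq> 1"
  proof -
    have s: "l - 1 \<in> {1..2*n}" "partner D (l - 1) = l \<or> l - 1 = partner D (l - 1) + 1"
      using that lr(1,8) short_chord_vertices_iff[OF D, of "l - 1"] by auto
    have "partner D (l - 1) \<noteq> l"
    proof
      assume e: "partner D (l - 1) = l"
      then have "partner D l = l - 1" using partner(4)[OF D s(1)] by simp
      moreover have "l \<in> {1..2 * n}" using lr(1-3) by simp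
      ultimately show False using l that short_chord_vertices_iff[OF D, of l] by simp
    qed
    with s have "partner D (l - 1) = l - 2" by auto
    then show ?thesis using partner(2,4)[OF D s(1)] by auto
  qed
  have R: "r + 2 \<le> 2 * n \<and> partner D (r + 1) = r + 2 \<and> partner D (r + 2) = r + 1" if "r \<noteq> 2 * n"
  proof -
    have s: "r + 1 \<in> {1..2*n}" "partner D (r + 1) = r + 2 \<or> r + 1 = partner D (r + 1) + 1"
      using that lr(1,9) short_chord_vertices_iff[OF D, of "r + 1"] by auto
    have "partner D (r + 1) \<noteq> r"
    proof
      assume e: "partner D (r + 1) = r"
      then have "partner D r = r + 1" using partner(4)[OF D s(1)] by simp
      moreover have "r \<in> {1..2 * n}" using lr(1-3) by simp
      ultimately show False using r short_chord_vertices_iff[OF D, of r] by simp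
    qed
    with s have "partner D (r + 1) = r + 2" by auto
    then show ?thesis using partner(2,4)[OF D s(1)] by auto
  qed
  have fl: "flank B = {l - 2, l - 1, r + 1, r + 2}"
    by (simp add: flank_def lr(5,6))
  \<comment> \<open>For \<open>l = 1\<close> truncated subtraction makes \<open>l - 1\<close> and
    \<open>l - 2\<close> equal to 0, which is not a vertex; for \<open>r = 2 * n\<close> the numbers
    \<open>r + 1\<close> and \<open>r + 2\<close> are too large.\<close>
  consider "l \<noteq> 1" "v = l - 2 \<or> v = l - 1" | "r \<noteq> 2 * n" "v = r + 1 \<or> v = r + 2"
    using v unfolding fl by (cases "l = 1"; cases "r = 2 * n") auto
  then have "v \<notin> {l..r} \<and> partner D v \<in> {l - 2, l - 1, r + 1, r + 2} \<and> partner D v \<notin> {l..r}"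
  proof cases
    case 1 then show ?thesis using L lr(2) by auto
  next
    case 2 then show ?thesis using R lr(2) by auto
  qed
  then show "v \<notin> B" "partner D v \<in> flank B" "partner D v \<notin> B"
    unfolding lr(4)[symmetric] fl[symmetric] by blast+
qed

lemma adjacent_in_flank:
  assumes B: "is_bubble n D B" and "v \<in> B" "w \<notin> B" "w \<ge> 1" "w = v + 1 \<or> v = w + 1"
  shows "w \<in> flank B"
proof -
  from B obtain l r where "B = {l..r}" "Min B = l" "Max B = r"
    by (rule is_bubble_interval)
  with assms(2-5) show ?thesis unfolding flank_def by auto
qed

lemma partner_bubble_not_adjacent:
  assumes D: "D \<in> linear_chord_diagrams n" and B: "is_bubble n D B" and v: "v \<in> B"
  shows "partner D v \<noteq> v + 1 \<and> v \<noteq> partner D v + 1"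
proof -
  have "v \<notin> short_chord_vertices D"
    using B v by (auto simp: is_bubble_def)
  then show ?thesis using short_chord_vertices_iff[OF D] is_bubble_subset[OF B] v by auto
qed

text \<open>Being a bubble reads the matching only on \<open>B\<close> and on its flank, so a
  switching may create or destroy short chords elsewhere without harm.\<close>

lemma is_bubble_transfer:
  assumes D: "D \<in> linear_chord_diagrams n" and D': "D' \<in> linear_chord_diagrams n"
    and B: "is_bubble n D B"
    and fl: "\<And>v. v \<in> flank B \<Longrightarrow> v \<in> {1..2 * n} \<Longrightarrow> partner D' v = partner D v"
    and na: "\<And>v. v \<in> B \<Longrightarrow> partner D' v \<noteq> v + 1 \<and> v \<noteq> partner D' v + 1"
  shows "is_bubble n D' B"
proof -
  from B obtain l r where lr: "1 \<le> l" "l \<le> r" "r \<le> 2 * n" "B = {l..r}" "Min B = l" "Max B = r"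
    "B \<inter> short_chord_vertices D = {}"
    "l = 1 \<or> l - 1 \<in> short_chord_vertices D" "r = 2 * n \<or> r + 1 \<in> short_chord_vertices D"
    by (rule is_bubble_interval)
  have fl': "v \<in> short_chord_vertices D'" if "v \<in> short_chord_vertices D" "v \<in> flank B" for v
    using that fl[of v] unfolding short_chord_vertices_iff[OF D] short_chord_vertices_iff[OF D']
    by auto
  have "B \<inter> short_chord_vertices D' = {}"
    using na short_chord_vertices_iff[OF D'] by auto
  moreover have "l = 1 \<or> l - 1 \<in> short_chord_vertices D'"
    using lr(8) fl'[of "l - 1"] by (auto simp: flank_def lr(5,6))
  moreover have "r = 2 * n \<or> r + 1 \<in> short_chord_vertices D'"
    using lr(9) fl'[of "r + 1"] by (auto simp: flank_def lr(5,6))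
  ultimately show ?thesis
    unfolding is_bubble_def using lr(1-4) by blast
qed

section \<open>Counting bridges by their ends\<close>

definition bridge_ends :: "nat set set \<Rightarrow> nat set \<Rightarrow> nat set" where
  "bridge_ends D B = {v \<in> B. partner D v \<notin> B}"

text \<open>A bridge has exactly one end in the bubble, and that end determines the chord.\<close>

lemma card_bridges:
  assumes D: "D \<in> linear_chord_diagrams n" and B: "B \<subseteq> {1..2 * n}"
  shows "card (bridges D B) = card (bridge_ends D B)"
proof -
  have "bij_betw (\<lambda>v. {v, partner D v}) (bridge_ends D B) (bridges D B)"
    unfolding bij_betw_def
  proof
    show "inj_on (\<lambda>v. {v, partner D v}) (bridge_ends D B)"
      by (rule inj_onI) (auto simp: bridge_ends_def doubleton_eq_iff)
    show "(\<lambda>v. {v, partner D v}) ` bridge_ends D B = bridges D B"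
    proof (intro equalityI subsetI)
      fix c assume "c \<in> (\<lambda>v. {v, partner D v}) ` bridge_ends D B"
      then show "c \<in> bridges D B"
        using B partner(1)[OF D] by (auto simp: bridge_ends_def bridges_def)
    next
      fix c assume "c \<in> bridges D B"
      then obtain x y where "{x, y} \<in> D" "c = {x, y}" "x \<in> B" "y \<notin> B"
        unfolding bridges_def by blast
      with partner_eqI[OF D] show "c \<in> (\<lambda>v. {v, partner D v}) ` bridge_ends D B"
        by (auto simp: bridge_ends_def intro!: image_eqI[of _ _ x])
    qed
  qed
  then show ?thesis by (simp add: bij_betw_same_card)
qed

definition inner_vertices :: "nat set set \<Rightarrow> nat set \<Rightarrow> nat set" where
  "inner_vertices D B = {v \<in> B. partner D v \<in> B}"

definition outer_vertices :: "nat \<Rightarrow> nat set set \<Rightarrow> nat set \<Rightarrow> nat set" where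
  "outer_vertices n D B = {v \<in> {1..2 * n} - B. partner D v \<notin> B}"

lemma card_inner_outer_vertices:
  assumes D: "D \<in> linear_chord_diagrams n" and B: "B \<subseteq> {1..2 * n}"
  shows "card (bridge_ends D B) + card (inner_vertices D B) = card B"
    and "card (bridge_ends D B) + card (outer_vertices n D B) + card B = 2 * n"
proof -
  have fin: "finite B" using B by (rule finite_subset) simp
  have "B = bridge_ends D B \<union> inner_vertices D B" "bridge_ends D B \<inter> inner_vertices D B = {}"
    by (auto simp: bridge_ends_def inner_vertices_def)
  then show "card (bridge_ends D B) + card (inner_vertices D B) = card B"
    using fin by (metis card_Un_disjoint finite_Un)
  \<comment> \<open>The outside vertices not in \<open>outer_vertices\<close> are exactly the far
    ends of the bridges.\<close>
  have "bij_betw (partner D) (bridge_ends D B) ({1..2 * n} - B - outer_vertices n D B)"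
    by (rule bij_betw_byWitness[where f' = "partner D"])
      (use partner[OF D] B in \<open>auto simp: bridge_ends_def outer_vertices_def subset_iff\<close>)
  then have "card (bridge_ends D B) = card ({1..2 * n} - B - outer_vertices n D B)"
    by (rule bij_betw_same_card)
  also have "\<dots> = card ({1..2 * n} - B) - card (outer_vertices n D B)"
    by (intro card_Diff_subset) (auto simp: outer_vertices_def)
  finally have "card (bridge_ends D B) = card ({1..2 * n} - B) - card (outer_vertices n D B)" .
  moreover have "card (outer_vertices n D B) \<le> card ({1..2 * n} - B)"
    by (intro card_mono) (auto simp: outer_vertices_def)
  moreover have "card ({1..2 * n} - B) + card B = 2 * n"
    using card_mono[OF _ B] card_Diff_subset[OF fin B] by simp
  ultimately show "card (bridge_ends D B) + card (outer_vertices n D B) + card B = 2 * n"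
    by linarith
qed

section \<open>The switching bijection\<close>

definition bridge_pairs :: "nat set set \<Rightarrow> nat set \<Rightarrow> (nat \<times> nat) set" where
  "bridge_pairs D B = {(x, x'). x \<in> bridge_ends D B \<and> x' \<in> bridge_ends D B \<and>
     x \<noteq> x' \<and> x' \<noteq> x + 1 \<and> x \<noteq> x' + 1}"

text \<open>A vertex stands for its chord together with a chosen end; an inner and an outer choice
  correspond to the ordered pairs in \<open>bridge_pairs\<close>. Flank vertices are left out
  because the short chords bounding \<open>B\<close> must survive.\<close>

definition switch_pairs :: "nat \<Rightarrow> nat set set \<Rightarrow> nat set \<Rightarrow> (nat \<times> nat) set" where
  "switch_pairs n D B = inner_vertices D B \<times> (outer_vertices n D B - flank B)"

text \<open>Swapping the labels of \<open>y = partner D x\<close> and \<open>x'\<close> turns the bridges \<open>{x, y}\<close>, \<open>{x', y'}\<close>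
  into the chords \<open>{x, x'}\<close>, \<open>{y, y'}\<close>.\<close>

lemma close_bridges:
  assumes D: "D \<in> linear_chord_diagrams n" and B: "is_bubble n D B"
    and xx: "(x, x') \<in> bridge_pairs D B"
  defines "D' \<equiv> (`) (Transposition.transpose (partner D x) x') ` D"
  shows "D' \<in> linear_chord_diagrams n" and "is_bubble n D' B"
    and "(x, partner D x) \<in> switch_pairs n D' B" and "partner D' x = x'"
    and "card (bridge_ends D B) = card (bridge_ends D' B) + 2"
proof -
  define y y' where "y = partner D x" and "y' = partner D x'"
  have BS: "B \<subseteq> {1..2 * n}" by (rule is_bubble_subset[OF B])
  have xx': "x \<in> B" "x' \<in> B" "y \<notin> B" "y' \<notin> B" "x \<noteq> x'" "x' \<noteq> x + 1" "x \<noteq> x' + 1"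
    using xx by (auto simp: bridge_pairs_def bridge_ends_def y_def y'_def)
  have x: "x \<in> {1..2 * n}" "x' \<in> {1..2 * n}" using xx' BS by auto
  have y: "y \<in> {1..2 * n}" "y' \<in> {1..2 * n}" "partner D y = x" "partner D y' = x'"
    using partner[OF D x(1)] partner[OF D x(2)] by (auto simp: y_def y'_def)
  have yy': "y \<noteq> y'" using y(3,4) xx'(5) by metis
  have D'_def': "D' = (`) (Transposition.transpose y x') ` D" by (simp add: D'_def y_def)
  show D': "D' \<in> linear_chord_diagrams n"
    unfolding D'_def' by (rule relabel_diagram[OF D y(1) x(2)])
  have p': "partner D' v =
      Transposition.transpose y x' (partner D (Transposition.transpose y x' v))"
    if "v \<in> {1..2 * n}" for v
    unfolding D'_def' by (rule partner_relabel[OF D y(1) x(2) that])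
  have px: "partner D' x = x'" using p'[OF x(1)] xx' by (metis transpose_apply_first transpose_apply_other y_def)
  have px': "partner D' x' = x" using px partner(4)[OF D' x(1)] by simp
  have py: "partner D' y = y'" using p'[OF y(1)] xx' yy'
    by (metis transpose_apply_first transpose_apply_other y'_def)
  have py': "partner D' y' = y" using py partner(4)[OF D' y(1)] by simp
  have po: "partner D' v = partner D v" if v: "v \<in> {1..2 * n}" "v \<noteq> x" "v \<noteq> x'" "v \<noteq> y" "v \<noteq> y'" for v
  proof -
    have "partner D v \<noteq> y" "partner D v \<noteq> x'"
      using v partner(4)[OF D v(1)] y y'_def by metis+
    then show ?thesis using p'[OF v(1)] v by simp
  qed
  show "partner D' x = x'" by (rule px)
  \<comment> \<open>Flank vertices are matched outside \<open>B\<close>, whereas \<open>y\<close>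
    and \<open>y'\<close> are matched into \<open>B\<close>.\<close>
  have nfl: "y \<notin> flank B" "y' \<notin> flank B"
    using flank_partner(3)[OF D B] y xx' by auto
  show B': "is_bubble n D' B"
  proof (rule is_bubble_transfer[OF D D' B])
    fix v assume v: "v \<in> flank B" "v \<in> {1..2 * n}"
    then show "partner D' v = partner D v"
      using po flank_partner(1)[OF D B v] nfl xx' by metis
  next
    fix v assume v: "v \<in> B"
    show "partner D' v \<noteq> v + 1 \<and> v \<noteq> partner D' v + 1"
    proof (cases "v = x \<or> v = x'")
      \<comment> \<open>\<open>{x, x'}\<close> is the only new chord meeting \<open>B\<close>; the
        non-adjacency required in \<open>bridge_pairs\<close> keeps it from being short.\<close>
      case True then show ?thesis using px px' xx' by auto
    next
      case False
      then have "partner D' v = partner D v" using v xx' BS by (intro po) auto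
      then show ?thesis using partner_bubble_not_adjacent[OF D B v] by simp
    qed
  qed
  show "(x, partner D x) \<in> switch_pairs n D' B"
    unfolding y_def[symmetric] switch_pairs_def inner_vertices_def outer_vertices_def
    using xx' px py y nfl by auto
  have "bridge_ends D B = insert x (insert x' (bridge_ends D' B))"
  proof (rule set_eqI)
    fix v show "v \<in> bridge_ends D B \<longleftrightarrow> v \<in> insert x (insert x' (bridge_ends D' B))"
    proof (cases "v = x \<or> v = x' \<or> v \<notin> B")
      case True then show ?thesis using xx' by (auto simp: bridge_ends_def y_def y'_def)
    next
      case False
      then have "partner D' v = partner D v" using xx' BS by (intro po) auto
      then show ?thesis using False by (auto simp: bridge_ends_def)
    qed
  qed
  moreover have "x \<notin> bridge_ends D' B" "x' \<notin> bridge_ends D' B"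
    using px px' xx' by (auto simp: bridge_ends_def)
  moreover have "finite (bridge_ends D' B)"
    using finite_subset[OF BS] by (auto simp: bridge_ends_def)
  ultimately show "card (bridge_ends D B) = card (bridge_ends D' B) + 2"
    using xx'(5) by simp
qed

text \<open>The inverse of \<open>close_bridges\<close>. The resulting pair is non-adjacent because
  a chord inside a bubble is never short. The new bridges are not short because outside neighbours
  of \<open>B\<close> lie in the flank, which contains neither \<open>y\<close> nor its
  partner.\<close>

lemma open_bridges:
  assumes D: "D \<in> linear_chord_diagrams n" and B: "is_bubble n D B"
    and xy: "(x, y) \<in> switch_pairs n D B"
  defines "D' \<equiv> (`) (Transposition.transpose y (partner D x)) ` D"
  shows "D' \<in> linear_chord_diagrams n" and "is_bubble n D' B"
    and "(x, partner D x) \<in> bridge_pairs D' B" and "partner D' x = y"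
proof -
  define x' y' where "x' = partner D x" and "y' = partner D y"
  have BS: "B \<subseteq> {1..2 * n}" by (rule is_bubble_subset[OF B])
  have xx': "x \<in> B" "x' \<in> B" "y \<notin> B" "y' \<notin> B" and y1: "y \<in> {1..2 * n}" "y \<notin> flank B"
    using xy by (auto simp: switch_pairs_def inner_vertices_def outer_vertices_def x'_def y'_def)
  have x: "x \<in> {1..2 * n}" "x' \<in> {1..2 * n}" using xx' BS by auto
  have xne: "x \<noteq> x'" "x' \<noteq> x + 1" "x \<noteq> x' + 1"
    using partner(3)[OF D x(1)] partner_bubble_not_adjacent[OF D B xx'(1)] by (auto simp: x'_def)
  have y: "y' \<in> {1..2 * n}" "partner D x' = x" "partner D y' = y" "y \<noteq> y'"
    using partner[OF D x(1)] partner[OF D y1(1)] by (auto simp: x'_def y'_def)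
  have D'_def': "D' = (`) (Transposition.transpose y x') ` D" by (simp add: D'_def x'_def)
  show D': "D' \<in> linear_chord_diagrams n"
    unfolding D'_def' by (rule relabel_diagram[OF D y1(1) x(2)])
  have p': "partner D' v =
      Transposition.transpose y x' (partner D (Transposition.transpose y x' v))"
    if "v \<in> {1..2 * n}" for v
    unfolding D'_def' by (rule partner_relabel[OF D y1(1) x(2) that])
  have px: "partner D' x = y" using p'[OF x(1)] xx' xne
    by (metis transpose_apply_second transpose_apply_other x'_def)
  have px': "partner D' x' = y'" using p'[OF x(2)] xx' y
    by (metis transpose_apply_second transpose_apply_other y'_def)
  have po: "partner D' v = partner D v" if v: "v \<in> {1..2 * n}" "v \<noteq> x" "v \<noteq> x'" "v \<noteq> y" "v \<noteq> y'" for v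
  proof -
    have "partner D v \<noteq> y" "partner D v \<noteq> x'"
      using v partner(4)[OF D v(1)] y y'_def by metis+
    then show ?thesis using p'[OF v(1)] v by simp
  qed
  show "partner D' x = y" by (rule px)
  have nfl: "y' \<notin> flank B"
    using flank_partner(2)[OF D B, of y'] y y1 by auto
  have adj: "w \<noteq> v + 1 \<and> v \<noteq> w + 1" if "v \<in> B" "w \<notin> B" "w \<in> {1..2 * n}" "w \<notin> flank B" for v w
    using adjacent_in_flank[OF B that(1,2)] that(3,4) by auto
  show B': "is_bubble n D' B"
  proof (rule is_bubble_transfer[OF D D' B])
    fix v assume v: "v \<in> flank B" "v \<in> {1..2 * n}"
    then show "partner D' v = partner D v"
      using po flank_partner(1)[OF D B v] nfl y1 xx' by metis
  next
    fix v assume v: "v \<in> B"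
    show "partner D' v \<noteq> v + 1 \<and> v \<noteq> partner D' v + 1"
    proof (cases "v = x \<or> v = x'")
      case True then show ?thesis using px px' xx' adj y1 y nfl by metis
    next
      case False
      then have "partner D' v = partner D v" using v xx' BS by (intro po) auto
      then show ?thesis using partner_bubble_not_adjacent[OF D B v] by simp
    qed
  qed
  show "(x, partner D x) \<in> bridge_pairs D' B"
    unfolding x'_def[symmetric] bridge_pairs_def bridge_ends_def
    using xx' px px' xne by auto
qed

text \<open>Double counting: closing is a bijection from bubbles with a marked bridge pair to
  bubbles with a marked switch pair. It lowers the number of bridges by 2, whence the shift in
  \<open>F\<close>.\<close>

lemma sum_switching:
  fixes F :: "nat \<Rightarrow> 'a::real_normed_vector"
  shows "(\<Sum>(D, B)\<in>sized_bubbles n q. real (card (bridge_pairs D B)) *\<^sub>R F (card (bridge_ends D B)))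
    = (\<Sum>(D, B)\<in>sized_bubbles n q. real (card (switch_pairs n D B)) *\<^sub>R F (card (bridge_ends D B) + 2))"
proof -
  let ?S = "sized_bubbles n q"
  let ?X = "Sigma ?S (\<lambda>(D, B). bridge_pairs D B)"
  let ?Y = "Sigma ?S (\<lambda>(D, B). switch_pairs n D B)"
  let ?f = "\<lambda>((D, B), x, x'). (((`) (Transposition.transpose (partner D x) x') ` D, B), x, partner D x)"
  \<comment> \<open>The mark left by \<open>?f\<close> records the old partner of \<open>x\<close>,
    and \<open>x'\<close> is the new one, so the same transposition can be read off and applied
    again.\<close>
  let ?g = "\<lambda>((D, B), x, y). (((`) (Transposition.transpose y (partner D x)) ` D, B), x, partner D x)"
  have S: "(D, B) \<in> ?S \<longleftrightarrow> D \<in> linear_chord_diagrams n \<and> is_bubble n D B \<and> int (card B) = q" for D B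
    by (simp add: sized_bubbles_def)
  have finB: "finite B" if "(D, B) \<in> ?S" for D B
    using is_bubble_subset[of n D B] that finite_subset by (auto simp: S)
  have fin: "finite (bridge_pairs D B)" "finite (switch_pairs n D B)" if "(D, B) \<in> ?S" for D B
  proof -
    have "bridge_pairs D B \<subseteq> B \<times> B" "switch_pairs n D B \<subseteq> B \<times> {1..2 * n}"
      by (auto simp: bridge_pairs_def bridge_ends_def switch_pairs_def inner_vertices_def outer_vertices_def)
    then show "finite (bridge_pairs D B)" "finite (switch_pairs n D B)"
      using finB[OF that] by (simp_all add: finite_subset[OF _ finite_cartesian_product])
  qed
  have bij: "bij_betw ?f ?X ?Y"
  proof (rule bij_betw_byWitness[where f' = ?g])
    show "\<forall>a\<in>?X. ?g (?f a) = a"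
    proof
      fix a assume "a \<in> ?X"
      then obtain D B x x' where a: "a = ((D, B), x, x')" and "(D, B) \<in> ?S" "(x, x') \<in> bridge_pairs D B"
        by auto
      then have "partner ((`) (Transposition.transpose (partner D x) x') ` D) x = x'"
        using close_bridges(4)[of D n B x x'] by (simp add: S)
      then show "?g (?f a) = a"
        by (simp only: a prod.case relabel_relabel)
    qed
    show "\<forall>a\<in>?Y. ?f (?g a) = a"
    proof
      fix a assume "a \<in> ?Y"
      then obtain D B x y where a: "a = ((D, B), x, y)" and "(D, B) \<in> ?S" "(x, y) \<in> switch_pairs n D B"
        by auto
      then have "partner ((`) (Transposition.transpose y (partner D x)) ` D) x = y"
        using open_bridges(4)[of D n B x y] by (simp add: S)
      then show "?f (?g a) = a"
        by (simp only: a prod.case relabel_relabel)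
    qed
    show "?f ` ?X \<subseteq> ?Y"
    proof (rule image_subsetI)
      fix a assume "a \<in> ?X"
      then obtain D B x x' where "a = ((D, B), x, x')" "(D, B) \<in> ?S" "(x, x') \<in> bridge_pairs D B"
        by auto
      then show "?f a \<in> ?Y"
        using close_bridges(1-3)[of D n B x x'] by (simp add: S)
    qed
    show "?g ` ?Y \<subseteq> ?X"
    proof (rule image_subsetI)
      fix a assume "a \<in> ?Y"
      then obtain D B x y where "a = ((D, B), x, y)" "(D, B) \<in> ?S" "(x, y) \<in> switch_pairs n D B"
        by auto
      then show "?g a \<in> ?X"
        using open_bridges(1-3)[of D n B x y] by (simp add: S)
    qed
  qed
  have "(\<Sum>(D, B)\<in>?S. real (card (bridge_pairs D B)) *\<^sub>R F (card (bridge_ends D B)))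
      = (\<Sum>z\<in>?S. \<Sum>w\<in>(\<lambda>(D, B). bridge_pairs D B) z. F (card (bridge_ends (fst z) (snd z))))"
    by (intro sum.cong) (auto simp: sum_constant_scaleR)
  also have "\<dots> = (\<Sum>(z, w)\<in>?X. F (card (bridge_ends (fst z) (snd z))))"
    by (rule sum.Sigma) (use fin in \<open>auto simp: finite_sized_bubbles\<close>)
  also have "\<dots> = (\<Sum>a\<in>?X. (\<lambda>(z, w). F (card (bridge_ends (fst z) (snd z)) + 2)) (?f a))"
  proof (rule sum.cong[OF refl])
    fix a assume "a \<in> ?X"
    then obtain D B x x' where a: "a = ((D, B), x, x')" and "(D, B) \<in> ?S" "(x, x') \<in> bridge_pairs D B"
      by auto
    then have "card (bridge_ends D B) =
        card (bridge_ends ((`) (Transposition.transpose (partner D x) x') ` D) B) + 2"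
      using close_bridges(5)[of D n B x x'] by (simp add: S)
    then show "(case a of (z, w) \<Rightarrow> F (card (bridge_ends (fst z) (snd z)))) =
        (\<lambda>(z, w). F (card (bridge_ends (fst z) (snd z)) + 2)) (?f a)"
      by (simp add: a)
  qed
  also have "\<dots> = (\<Sum>(z, w)\<in>?Y. F (card (bridge_ends (fst z) (snd z)) + 2))"
    by (rule sum.reindex_bij_betw[OF bij])
  also have "\<dots> = (\<Sum>z\<in>?S. \<Sum>w\<in>(\<lambda>(D, B). switch_pairs n D B) z. F (card (bridge_ends (fst z) (snd z)) + 2))"
    by (rule sum.Sigma[symmetric]) (use fin in \<open>auto simp: finite_sized_bubbles\<close>)
  also have "\<dots> = (\<Sum>(D, B)\<in>?S. real (card (switch_pairs n D B)) *\<^sub>R F (card (bridge_ends D B) + 2))"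
    by (intro sum.cong) (auto simp: sum_constant_scaleR)
  finally show ?thesis .
qed

section \<open>Cost of the adjacency and flank constraints\<close>

lemma card_bridge_pairs:
  assumes "finite B"
  shows "card (bridge_pairs D B) \<le> (card (bridge_ends D B))\<^sup>2"
    and "(card (bridge_ends D B))\<^sup>2 \<le> card (bridge_pairs D B) + 3 * card (bridge_ends D B)"
proof -
  define U where "U = bridge_ends D B"
  have fin: "finite U" using assms by (simp add: U_def bridge_ends_def)
  have sub: "bridge_pairs D B \<subseteq> U \<times> U"
    by (auto simp: bridge_pairs_def U_def)
  have sq: "(card U)\<^sup>2 = card (U \<times> U)" by (simp add: power2_eq_square card_cartesian_product)
  show "card (bridge_pairs D B) \<le> (card (bridge_ends D B))\<^sup>2"
    unfolding U_def[symmetric] sq using sub fin by (intro card_mono) auto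
  \<comment> \<open>The excluded pairs lie on the diagonal and its two neighbours, each with at most
    one pair per element of \<open>U\<close>; hence the 3.\<close>
  have "U \<times> U \<subseteq> bridge_pairs D B \<union> (\<lambda>x. (x, x)) ` U \<union> (\<lambda>x. (x, x + 1)) ` U \<union> (\<lambda>x. (x + 1, x)) ` U"
    by (auto simp: bridge_pairs_def U_def)
  moreover have "finite (bridge_pairs D B)"
    using sub fin by (auto intro: finite_subset)
  ultimately have "card (U \<times> U) \<le>
      card (bridge_pairs D B \<union> (\<lambda>x. (x, x)) ` U \<union> (\<lambda>x. (x, x + 1)) ` U \<union> (\<lambda>x. (x + 1, x)) ` U)"
    using fin by (intro card_mono) auto
  also have "\<dots> \<le> card (bridge_pairs D B) + card ((\<lambda>x. (x, x)) ` U) + card ((\<lambda>x. (x, x + 1)) ` U) +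
      card ((\<lambda>x. (x + 1, x)) ` U)"
    by (intro order.trans[OF card_Un_le] add_right_mono order.refl)
  also have "\<dots> = card (bridge_pairs D B) + 3 * card U"
    by (simp add: card_image inj_on_def)
  finally show "(card (bridge_ends D B))\<^sup>2 \<le> card (bridge_pairs D B) + 3 * card (bridge_ends D B)"
    unfolding U_def[symmetric] sq .
qed

text \<open>Without the flank condition the product would be exact. Each of the at most four flank
  vertices removes at most one pair per inner vertex, and there are at most \<open>q\<close> inner
  vertices.\<close>

lemma card_switch_pairs:
  assumes D: "D \<in> linear_chord_diagrams n" and B: "B \<subseteq> {1..2 * n}"
  defines "b \<equiv> real (card (bridge_ends D B))" and "q \<equiv> real (card B)"
  shows "\<bar>(q - b) * (2 * real n - q - b) - real (card (switch_pairs n D B))\<bar> \<le> 4 * q"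
proof -
  have i: "real (card (inner_vertices D B)) = q - b" and o: "real (card (outer_vertices n D B)) = 2 * real n - q - b"
    using card_inner_outer_vertices[OF D B] unfolding b_def q_def by linarith+
  define k where "k = real (card (outer_vertices n D B - flank B))"
  have "card (flank B) \<le> 4"
    unfolding flank_def using card_length[of "[Min B - 2, Min B - 1, Max B + 1, Max B + 2]"] by simp
  moreover have "card (outer_vertices n D B) - card (flank B) \<le> card (outer_vertices n D B - flank B)"
    by (rule diff_card_le_card_Diff) (simp add: flank_def)
  moreover have "card (outer_vertices n D B - flank B) \<le> card (outer_vertices n D B)"
    by (intro card_mono) (auto simp: outer_vertices_def)
  ultimately have k: "\<bar>2 * real n - q - b - k\<bar> \<le> 4"
    unfolding k_def o[symmetric] by linarith
  have "\<bar>(q - b) * (2 * real n - q - b) - real (card (switch_pairs n D B))\<bar>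
      = (q - b) * \<bar>2 * real n - q - b - k\<bar>"
    unfolding switch_pairs_def card_cartesian_product of_nat_mult i k_def[symmetric]
    using i by (simp add: right_diff_distrib[symmetric] abs_mult)
  also have "\<dots> \<le> q * 4"
    using i k by (intro mult_mono) (auto simp: b_def)
  finally show ?thesis by simp
qed

lemma sized_bubblesD:
  assumes "(D, B) \<in> sized_bubbles n q"
  shows "D \<in> linear_chord_diagrams n" "B \<subseteq> {1..2 * n}" "finite B" "real_of_int q = real (card B)"
    "card (bridges D B) = card (bridge_ends D B)"
    "real (card (bridges D B)) \<le> real_of_int q" "real (card (bridges D B)) \<le> 2 * real n - real_of_int q"
proof -
  show D: "D \<in> linear_chord_diagrams n" and B: "B \<subseteq> {1..2 * n}" and q: "real_of_int q = real (card B)"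
    using assms is_bubble_subset by (auto simp: sized_bubbles_def)
  show "finite B" using B by (rule finite_subset) simp
  show b: "card (bridges D B) = card (bridge_ends D B)"
    by (rule card_bridges[OF D B])
  show "real (card (bridges D B)) \<le> real_of_int q" "real (card (bridges D B)) \<le> 2 * real n - real_of_int q"
    unfolding b q using card_inner_outer_vertices[OF D B] by linarith+
qed

text \<open>The exact counts of \<open>sum_switching\<close> are replaced by their leading terms; 3
  and 4 are the losses in \<open>card_bridge_pairs\<close> and \<open>card_switch_pairs\<close>, the
  former with b bounded by \<open>r\<close>. The weights \<open>norm (F _)\<close> stay inside the
  sum so that unbounded \<open>F\<close> can be used.\<close>

lemma norm_sum_switching:
  fixes F :: "nat \<Rightarrow> 'a::real_normed_vector" and q :: int
  defines "b \<equiv> \<lambda>z. card (bridges (fst z) (snd z))" and "r \<equiv> real_of_int q"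
  shows "norm (\<Sum>z\<in>sized_bubbles n q. (real (b z))\<^sup>2 *\<^sub>R F (b z)
      - ((r - real (b z)) * (2 * real n - r - real (b z))) *\<^sub>R F (b z + 2))
    \<le> (\<Sum>z\<in>sized_bubbles n q. 3 * r * norm (F (b z)) + 4 * r * norm (F (b z + 2)))"
proof -
  let ?S = "sized_bubbles n q"
  define P Q where "P = (\<lambda>z. real (card (bridge_pairs (fst z) (snd z))))"
    and "Q = (\<lambda>z. real (card (switch_pairs n (fst z) (snd z))))"
  let ?f = "\<lambda>z. (real (b z))\<^sup>2 *\<^sub>R F (b z)
      - ((r - real (b z)) * (2 * real n - r - real (b z))) *\<^sub>R F (b z + 2)"
  let ?g = "\<lambda>z. ((real (b z))\<^sup>2 - P z) *\<^sub>R F (b z)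
      - ((r - real (b z)) * (2 * real n - r - real (b z)) - Q z) *\<^sub>R F (b z + 2)"
  have b: "b z = card (bridge_ends (fst z) (snd z))" if "z \<in> ?S" for z
    using sized_bubblesD(5)[of "fst z" "snd z"] that by (simp add: b_def)
  have "(\<Sum>z\<in>?S. P z *\<^sub>R F (b z)) = (\<Sum>z\<in>?S. Q z *\<^sub>R F (b z + 2))"
    using sum_switching[of F n q] b by (simp add: P_def Q_def case_prod_unfold)
  then have fg: "(\<Sum>z\<in>?S. ?f z) = (\<Sum>z\<in>?S. ?g z)"
    by (simp add: scaleR_diff_left sum_subtractf)
  have "norm (\<Sum>z\<in>?S. ?f z) \<le> (\<Sum>z\<in>?S. norm (?g z))"
    unfolding fg by (rule norm_sum)
  also have "\<dots> \<le> (\<Sum>z\<in>?S. 3 * r * norm (F (b z)) + 4 * r * norm (F (b z + 2)))"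
  proof (rule sum_mono)
    fix z assume z: "z \<in> ?S"
    then have z': "(fst z, snd z) \<in> ?S" by simp
    note d = sized_bubblesD[OF z']
    have "P z \<le> real ((b z)\<^sup>2)" "real ((b z)\<^sup>2) \<le> P z + real (3 * b z)"
      unfolding P_def b[OF z] using card_bridge_pairs[OF d(3), of "fst z"] by linarith+
    then have "\<bar>(real (b z))\<^sup>2 - P z\<bar> \<le> 3 * r"
      using d(6) by (simp add: b_def r_def)
    moreover have "\<bar>(r - real (b z)) * (2 * real n - r - real (b z)) - Q z\<bar> \<le> 4 * r"
      using card_switch_pairs[OF d(1,2)] by (simp add: b[OF z] r_def d(4) Q_def)
    ultimately have "norm (((real (b z))\<^sup>2 - P z) *\<^sub>R F (b z)) \<le> 3 * r * norm (F (b z))"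
      "norm (((r - real (b z)) * (2 * real n - r - real (b z)) - Q z) *\<^sub>R F (b z + 2))
        \<le> 4 * r * norm (F (b z + 2))"
      unfolding norm_scaleR by (simp_all only: mult_right_mono norm_ge_zero)
    then show "norm (?g z) \<le> 3 * r * norm (F (b z)) + 4 * r * norm (F (b z + 2))"
      by (rule order.trans[OF norm_triangle_ineq4 add_mono])
  qed
  finally show ?thesis .
qed

section \<open>The law of the number of bridges\<close>

lemma set_bridge_pmf:
  "sized_bubbles n q \<noteq> {} \<Longrightarrow>
    set_pmf (bridge_pmf n q) = (\<lambda>(D, B). card (bridges D B)) ` sized_bubbles n q"
  unfolding bridge_pmf_def by (simp add: finite_sized_bubbles)

lemma expectation_bridge_pmf:
  fixes g :: "nat \<Rightarrow> 'a::{banach, second_countable_topology}"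
  assumes ne: "sized_bubbles n q \<noteq> {}"
  shows "measure_pmf.expectation (bridge_pmf n q) g =
    (\<Sum>z\<in>sized_bubbles n q. g (card (bridges (fst z) (snd z)))) /\<^sub>R real (card (sized_bubbles n q))"
  unfolding bridge_pmf_def integral_map_pmf
  by (subst integral_measure_pmf[of "sized_bubbles n q"])
    (auto simp: ne finite_sized_bubbles scaleR_sum_right case_prod_unfold divide_inverse intro!: sum.cong)

lemma finite_bridge_pmf: "sized_bubbles n q \<noteq> {} \<Longrightarrow> finite (set_pmf (bridge_pmf n q))"
  by (simp add: set_bridge_pmf finite_sized_bubbles)

lemma bridge_pmf_le:
  assumes "sized_bubbles n q \<noteq> {}" "b \<in> set_pmf (bridge_pmf n q)"
  shows "real b \<le> real_of_int q" "real b \<le> 2 * real n - real_of_int q"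
  using assms sized_bubblesD(6,7) by (auto simp: set_bridge_pmf)

lemma expectation_switching:
  fixes F :: "nat \<Rightarrow> 'a::{banach, second_countable_topology}" and q :: int
  assumes ne: "sized_bubbles n q \<noteq> {}"
  defines "E \<equiv> \<lambda>g. measure_pmf.expectation (bridge_pmf n q) g" and "r \<equiv> real_of_int q"
  shows "norm (E (\<lambda>b. (real b)\<^sup>2 *\<^sub>R F b - ((r - real b) * (2 * real n - r - real b)) *\<^sub>R F (b + 2)))
    \<le> measure_pmf.expectation (bridge_pmf n q) (\<lambda>b. 3 * r * norm (F b) + 4 * r * norm (F (b + 2)))"
  unfolding E_def r_def expectation_bridge_pmf[OF ne] norm_scaleR real_scaleR_def abs_inverse abs_of_nat
  by (rule mult_left_mono[OF norm_sum_switching]) simp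

text \<open>Vertices \<open>q + 1\<close> and \<open>q + 2\<close> form a short chord, and the others are matched antipodally.\<close>

lemma sized_bubbles_nonempty:
  assumes q: "1 \<le> q" "q \<le> 2 * int n - 2" and n: "n \<ge> 3"
  shows "sized_bubbles n q \<noteq> {}"
proof -
  define k where "k = nat q"
  obtain h where h: "n = Suc h" "h \<ge> 2" using n by (intro that[of "n - 1"]) auto
  have k: "1 \<le> k" "k \<le> 2 * n - 2" using q by (auto simp: k_def)
  \<comment> \<open>The increasing enumeration of the vertices other than \<open>k + 1\<close> and
    \<open>k + 2\<close>. As \<open>h = n - 1\<close> is half their number, \<open>chd\<close>
    matches them antipodally.\<close>
  define e where "e = (\<lambda>i. if i \<le> k then i else i + 2)"
  define chd where "chd = (\<lambda>i. {e i, e (i + h)})"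
  define D where "D = insert {k + 1, k + 2} (chd ` {1..h})"
  have inj: "inj e" by (rule injI) (auto simp: e_def split: if_splits)
  have e_eq: "e i = e j \<longleftrightarrow> i = j" for i j by (rule inj_eq[OF inj])
  have e_ne: "e i \<noteq> k + 1" "e i \<noteq> k + 2" for i by (auto simp: e_def)
  have e_mem: "e i \<in> {1..2 * n}" if "i \<in> {1..2 * n - 2}" for i using that by (auto simp: e_def)
  have chd2: "card (chd i) = 2" for i
    using h by (simp add: chd_def e_eq)
  have D: "D \<in> linear_chord_diagrams n"
    unfolding linear_chord_diagrams_def
  proof (intro CollectI conjI partition_onI)
    show "\<Union> D = {1..2 * n}"
    proof (intro equalityI subsetI)
      fix v assume "v \<in> \<Union> D"
      then consider "v = k + 1 \<or> v = k + 2" | i where "i \<in> {1..h}" "v = e i \<or> v = e (i + h)"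
        by (auto simp: D_def chd_def)
      then show "v \<in> {1..2 * n}"
      proof cases
        case 1 then show ?thesis using k h by auto
      next
        case 2 then show ?thesis using e_mem[of i] e_mem[of "i + h"] h by auto
      qed
    next
      fix v assume v: "v \<in> {1..2 * n}"
      show "v \<in> \<Union> D"
      proof (cases "v = k + 1 \<or> v = k + 2")
        case True then show ?thesis by (auto simp: D_def)
      next
        case False
        obtain i where i: "v = e i" "i \<in> {1..2 * n - 2}"
        proof (cases "v \<le> k")
          case True then show thesis using that[of v] v k by (auto simp: e_def)
        next
          case F: False
          then have "v \<ge> k + 3" using False by auto
          then have "v = e (v - 2)" "v - 2 \<in> {1..2 * n - 2}" using v by (auto simp: e_def)
          then show thesis by (rule that)
        qed
        show ?thesis
        proof (cases "i \<le> h")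
          case True then show ?thesis using i by (auto simp: D_def chd_def)
        next
          case F: False
          then have "i - h \<in> {1..h}" "v \<in> chd (i - h)"
            using i h by (auto simp: chd_def)
          then show ?thesis by (auto simp: D_def)
        qed
      qed
    qed
    show "{} \<notin> D" by (auto simp: D_def chd_def)
    show "\<forall>c\<in>D. card c = 2" using chd2 by (auto simp: D_def)
    show "disjnt c d" if "c \<in> D" "d \<in> D" "c \<noteq> d" for c d
    proof -
      have 1: "disjnt (chd i) (chd j)" if "i \<in> {1..h}" "j \<in> {1..h}" "i \<noteq> j" for i j
        using that by (auto simp: chd_def disjnt_def e_eq)
      have 2: "disjnt {k + 1, k + 2} (chd i)" "disjnt (chd i) {k + 1, k + 2}" for i
        using e_ne[of i] e_ne[of "i + h"] unfolding chd_def disjnt_def by auto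
      show ?thesis using that 1 2 unfolding D_def by blast
    qed
  qed
  have "is_bubble n D {1..k}"
    unfolding is_bubble_def
  proof (rule exI[of _ 1], rule exI[of _ k], intro conjI)
    have "k + 1 \<in> short_chord_vertices D"
      unfolding short_chord_vertices_def short_chord_def D_def by auto
    then show "k = 2 * n \<or> k + 1 \<in> short_chord_vertices D" ..
    \<comment> \<open>Antipodal vertices are \<open>h\<close> apart with \<open>h \<ge> 2\<close>,
      by \<open>n \<ge> 3\<close>; skipping the two reserved vertices can only widen the
      gap.\<close>
    have far: "e (i + h) \<ge> e i + 2" for i using h by (auto simp: e_def)
    have "\<not> short_chord (chd i)" for i
    proof
      assume "short_chord (chd i)"
      then obtain j where "e i = j \<and> e (i + h) = j + 1 \<or> e i = j + 1 \<and> e (i + h) = j"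
        unfolding short_chord_def chd_def doubleton_eq_iff by blast
      then show False using far[of i] by linarith
    qed
    then have "short_chord_vertices D \<subseteq> {k + 1, k + 2}"
      unfolding short_chord_vertices_def D_def by auto
    then show "{1..k} \<inter> short_chord_vertices D = {}" by auto
  qed (use k in auto)
  then have "(D, {1..k}) \<in> sized_bubbles n q"
    using D q by (simp add: sized_bubbles_def k_def)
  then show ?thesis by blast
qed

section \<open>The Stein identity\<close>

text \<open>All that the limit theorem needs from chord diagrams: \<open>P\<close> is the law of b
  and \<open>m\<close> the number of vertices outside the bubble. Complex \<open>F\<close> serves
  both the moments and the characteristic function. The bound \<open>q + m \<ge> 1\<close> lets
  constants be absorbed into multiples of \<open>N\<close>.\<close>

locale switching_pmf =
  fixes P :: "nat pmf" and q m :: real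
  assumes fin: "finite (set_pmf P)"
    and pos: "q > 0" "m > 0" "q + m \<ge> 1"
    and le: "\<And>b. b \<in> set_pmf P \<Longrightarrow> real b \<le> q" "\<And>b. b \<in> set_pmf P \<Longrightarrow> real b \<le> m"
    and switching: "\<And>F :: nat \<Rightarrow> complex.
      norm (measure_pmf.expectation P (\<lambda>b. of_real ((real b)\<^sup>2) * F b - of_real ((q - real b) * (m - real b)) * F (b + 2)))
      \<le> measure_pmf.expectation P (\<lambda>b. 3 * q * norm (F b) + 4 * q * norm (F (b + 2)))"
begin

abbreviation E :: "(nat \<Rightarrow> 'a::{banach, second_countable_topology}) \<Rightarrow> 'a" where
  "E \<equiv> measure_pmf.expectation P"

definition N :: real where "N = q + m"

text \<open>The centre \<open>q * m / N\<close> is the only root of b^2 = (q - b) (m - b), the point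
  where closing and opening moves balance.\<close>

definition d :: "nat \<Rightarrow> real" where "d b = real b - q * m / N"

lemma integrable [simp]: "integrable P f" for f :: "nat \<Rightarrow> 'a::{banach, second_countable_topology}"
  by (rule integrable_measure_pmf_finite[OF fin])

lemma E_mono: "(\<And>b. b \<in> set_pmf P \<Longrightarrow> f b \<le> g b) \<Longrightarrow> E f \<le> E g" for f g :: "nat \<Rightarrow> real"
  by (rule integral_mono_AE) (auto simp: AE_measure_pmf_iff)

lemma norm_E: "norm (E f) \<le> E (\<lambda>b. norm (f b))" for f :: "nat \<Rightarrow> 'a::{banach, second_countable_topology}"
  by (rule integral_norm_bound)

lemma N: "N \<ge> 1" "N > 0" "q \<le> N" "q * m \<le> N\<^sup>2 / 4" "q\<^sup>2 + m\<^sup>2 \<le> N\<^sup>2"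
proof -
  show "N \<ge> 1" "N > 0" "q \<le> N" using pos by (auto simp: N_def)
  have "0 \<le> (q - m)\<^sup>2" by simp
  then show "q * m \<le> N\<^sup>2 / 4" by (simp add: N_def power2_eq_square algebra_simps)
  have "0 \<le> q * m" using pos by simp
  then show "q\<^sup>2 + m\<^sup>2 \<le> N\<^sup>2" by (simp add: N_def power2_eq_square algebra_simps)
qed

lemma N_mult_d: "N * d b = (real b)\<^sup>2 - (q - real b) * (m - real b)"
  using N(2) by (simp add: d_def field_simps power2_eq_square) (simp add: N_def algebra_simps)

text \<open>Expansion about the centre, where the two factors equal q^2 / N and m^2 / N. The
  constant term is what produces the variance.\<close>

lemma product_eq: "(q - real b) * (m - real b) = (q * m / N)\<^sup>2 - d b * ((q\<^sup>2 + m\<^sup>2) / N) + (d b)\<^sup>2"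
proof -
  have "q - real b = q\<^sup>2 / N - d b" "m - real b = m\<^sup>2 / N - d b"
    using N(2) by (simp_all add: d_def field_simps power2_eq_square) (simp_all add: N_def algebra_simps)
  then have "(q - real b) * (m - real b) = (q\<^sup>2 / N - d b) * (m\<^sup>2 / N - d b)" by simp
  also have "\<dots> = (q * m / N)\<^sup>2 - d b * ((q\<^sup>2 + m\<^sup>2) / N) + (d b)\<^sup>2"
    by (simp add: algebra_simps add_divide_distrib power2_eq_square)
  finally show ?thesis .
qed

lemma stein:
  fixes F :: "nat \<Rightarrow> complex"
  shows "norm (of_real N * E (\<lambda>b. of_real (d b) * F b)
      - E (\<lambda>b. of_real ((q - real b) * (m - real b)) * (F (b + 2) - F b)))
    \<le> N * E (\<lambda>b. 3 * norm (F b) + 4 * norm (F (b + 2)))"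
proof -
  have "of_real N * E (\<lambda>b. of_real (d b) * F b)
      - E (\<lambda>b. of_real ((q - real b) * (m - real b)) * (F (b + 2) - F b))
      = E (\<lambda>b. of_real (N * d b) * F b - of_real ((q - real b) * (m - real b)) * (F (b + 2) - F b))"
    by (simp add: mult.assoc)
  also have "\<dots> = E (\<lambda>b. of_real ((real b)\<^sup>2) * F b - of_real ((q - real b) * (m - real b)) * F (b + 2))"
    unfolding N_mult_d by (intro Bochner_Integration.integral_cong refl) (simp add: algebra_simps)
  also have "norm \<dots> \<le> E (\<lambda>b. 3 * q * norm (F b) + 4 * q * norm (F (b + 2)))"
    by (rule switching)
  also have "\<dots> = q * E (\<lambda>b. 3 * norm (F b) + 4 * norm (F (b + 2)))"
    by (simp add: algebra_simps)
  also have "\<dots> \<le> N * E (\<lambda>b. 3 * norm (F b) + 4 * norm (F (b + 2)))"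
    by (intro mult_right_mono N Bochner_Integration.integral_nonneg) simp
  finally show ?thesis .
qed

lemma stein_real:
  fixes f :: "nat \<Rightarrow> real"
  shows "\<bar>N * E (\<lambda>b. d b * f b) - E (\<lambda>b. (q - real b) * (m - real b) * (f (b + 2) - f b))\<bar>
    \<le> N * E (\<lambda>b. 3 * \<bar>f b\<bar> + 4 * \<bar>f (b + 2)\<bar>)"
proof -
  have "of_real N * E (\<lambda>b. of_real (d b) * of_real (f b))
      - E (\<lambda>b. of_real ((q - real b) * (m - real b)) * (of_real (f (b + 2)) - of_real (f b)))
      = complex_of_real (N * E (\<lambda>b. d b * f b) - E (\<lambda>b. (q - real b) * (m - real b) * (f (b + 2) - f b)))"
    unfolding of_real_diff[symmetric] of_real_mult[symmetric] integral_complex_of_real ..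
  with stein[of "\<lambda>b. of_real (f b)"] show ?thesis
    by (simp only: norm_of_real)
qed

section \<open>Mean and variance\<close>

lemma abs_E_d: "\<bar>E d\<bar> \<le> 7"
proof -
  \<comment> \<open>The constant test function has increment 0, so only the error remains, and 7 = 3
    + 4.\<close>
  have "\<bar>N * E d\<bar> \<le> N * 7" using stein_real[of "\<lambda>_. 1"] by simp
  then show ?thesis using N(2) by (simp add: abs_mult)
qed

lemma stein_square: "\<bar>N * E (\<lambda>b. (d b)\<^sup>2) - 2 * E (\<lambda>b. (q - real b) * (m - real b))\<bar>
  \<le> N * (7 * E (\<lambda>b. \<bar>d b\<bar>) + 8)"
proof -
  have d2: "d (b + 2) = d b + 2" "d (b + 2) - d b = 2" for b by (simp_all add: d_def)
  have "\<bar>N * E (\<lambda>b. (d b)\<^sup>2) - 2 * E (\<lambda>b. (q - real b) * (m - real b))\<bar>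
      \<le> N * E (\<lambda>b. 3 * \<bar>d b\<bar> + 4 * \<bar>d (b + 2)\<bar>)"
    using stein_real[of d] unfolding d2(2) by (simp add: power2_eq_square mult_ac)
  also have "E (\<lambda>b. 3 * \<bar>d b\<bar> + 4 * \<bar>d (b + 2)\<bar>) \<le> E (\<lambda>b. 7 * \<bar>d b\<bar> + 8)"
    proof (rule E_mono)
    show "3 * \<bar>d b\<bar> + 4 * \<bar>d (b + 2)\<bar> \<le> 7 * \<bar>d b\<bar> + 8" for b
      using abs_triangle_ineq[of "d b" 2] unfolding d2(1) by simp
  qed
  also have "\<dots> = 7 * E (\<lambda>b. \<bar>d b\<bar>) + 8" by simp
  finally show ?thesis using N(2) by simp
qed

text \<open>An a priori bound is needed because the remainder of \<open>stein_square\<close> itself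
  contains E |d|.\<close>

lemma E_square_le: "E (\<lambda>b. (d b)\<^sup>2) \<le> 66 * N"
proof -
  have "E (\<lambda>b. (q - real b) * (m - real b)) \<le> E (\<lambda>b. q * m)"
    using le pos by (intro E_mono mult_mono) auto
  then have "2 * E (\<lambda>b. (q - real b) * (m - real b)) \<le> N * (N / 2)"
    using N(4) by (simp add: power2_eq_square)
  with stein_square have "N * E (\<lambda>b. (d b)\<^sup>2) \<le> N * (N / 2 + 7 * E (\<lambda>b. \<bar>d b\<bar>) + 8)"
    by (simp add: algebra_simps)
  then have 1: "E (\<lambda>b. (d b)\<^sup>2) \<le> N / 2 + 7 * E (\<lambda>b. \<bar>d b\<bar>) + 8"
    using N(2) by simp
  \<comment> \<open>The weights are chosen so that 7 |d| is at most d^2 / 2 + 49 / 2. Half of the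
    second moment is absorbed on the left, which leaves the bound N + 65, at most 66 N.\<close>
  have "E (\<lambda>b. \<bar>d b\<bar>) \<le> E (\<lambda>b. (d b)\<^sup>2 / 14 + 7 / 2)"
  proof (rule E_mono)
    fix b have "0 \<le> (\<bar>d b\<bar> - 7)\<^sup>2" by simp
    then show "\<bar>d b\<bar> \<le> (d b)\<^sup>2 / 14 + 7 / 2" by (simp add: power2_diff)
  qed
  with 1 show ?thesis using N(1) by simp
qed

lemma E_abs_le: "E (\<lambda>b. \<bar>d b\<bar>) \<le> 34 * sqrt N"
proof -
  have s: "sqrt N > 0" using N(2) by simp
  \<comment> \<open>The same inequality, now balanced at the true scale \<open>sqrt N\<close> of
    d.\<close>
  have "E (\<lambda>b. \<bar>d b\<bar>) \<le> E (\<lambda>b. (d b)\<^sup>2 / (2 * sqrt N) + sqrt N / 2)"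
  proof (rule E_mono)
    fix b have "0 \<le> (\<bar>d b\<bar> - sqrt N)\<^sup>2" by simp
    then show "\<bar>d b\<bar> \<le> (d b)\<^sup>2 / (2 * sqrt N) + sqrt N / 2"
      using s N(2) by (simp add: power2_diff field_simps)
  qed
  also have "\<dots> = E (\<lambda>b. (d b)\<^sup>2) / (2 * sqrt N) + sqrt N / 2" by simp
  also have "\<dots> \<le> (66 * N) / (2 * sqrt N) + sqrt N / 2"
    using E_square_le s by (intro add_right_mono divide_right_mono) auto
  also have "\<dots> = 33 * sqrt N + sqrt N / 2"
    using s N(2) by (simp add: field_simps)
  finally show ?thesis using s by linarith
qed

lemma sqrt_N: "sqrt N \<ge> 1"
  using N(1) by simp

text \<open>The main term is the constant term of \<open>product_eq\<close>. In 392, the part 7 * 34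
  + 8 comes from the remainder of \<open>stein_square\<close>, and 14 + 132 from twice the bounds 7
  N and 66 N on the linear and quadratic terms.\<close>

lemma E_square_asymp: "\<bar>E (\<lambda>b. (d b)\<^sup>2) - 2 * (q * m)\<^sup>2 / N ^ 3\<bar> \<le> 392 * sqrt N"
proof -
  have abs_linear: "\<bar>w - 2 * k\<bar> \<le> e + 14 * N + 132 * N"
    if "\<bar>w - 2 * (k - x + v)\<bar> \<le> e" "\<bar>x\<bar> \<le> 7 * N" "0 \<le> v" "v \<le> 66 * N" for w k x v e
    using that unfolding abs_le_iff by argo
  define v where "v = E (\<lambda>b. (d b)\<^sup>2)"
  have v: "0 \<le> v" "v \<le> 66 * N" using E_square_le by (auto simp: v_def)
  have "E (\<lambda>b. (q - real b) * (m - real b)) = (q * m / N)\<^sup>2 - E d * ((q\<^sup>2 + m\<^sup>2) / N) + v"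
    unfolding product_eq v_def by simp
  with stein_square have 1: "\<bar>N * v - 2 * ((q * m / N)\<^sup>2 - E d * ((q\<^sup>2 + m\<^sup>2) / N) + v)\<bar>
      \<le> N * (7 * E (\<lambda>b. \<bar>d b\<bar>) + 8)" by (simp add: v_def)
  have "\<bar>E d * ((q\<^sup>2 + m\<^sup>2) / N)\<bar> = \<bar>E d\<bar> * ((q\<^sup>2 + m\<^sup>2) / N)"
    using N(2) by (simp add: abs_mult)
  also have "\<dots> \<le> 7 * (N\<^sup>2 / N)"
    using N abs_E_d by (intro mult_mono divide_right_mono) auto
  finally have 2: "\<bar>E d * ((q\<^sup>2 + m\<^sup>2) / N)\<bar> \<le> 7 * N"
    using N(2) by (simp add: power2_eq_square)
  have "N * (7 * E (\<lambda>b. \<bar>d b\<bar>) + 8) \<le> N * (7 * (34 * sqrt N) + 8)"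
    using E_abs_le N(2) by simp
  then have "\<bar>N * v - 2 * (q * m / N)\<^sup>2\<bar> \<le> N * (7 * (34 * sqrt N) + 8) + 14 * N + 132 * N"
    using abs_linear[OF 1 2 v] by linarith
  also have "\<dots> \<le> N * (392 * sqrt N)"
    using sqrt_N N(2) by (simp add: algebra_simps)
  also have "N * v - 2 * (q * m / N)\<^sup>2 = N * (v - 2 * (q * m)\<^sup>2 / N ^ 3)"
    using N(2) by (simp add: field_simps power2_eq_square power3_eq_cube)
  finally show ?thesis
    using N(2) by (simp add: abs_mult v_def)
qed

lemma mean_asymp: "\<bar>E real - q * m / N\<bar> \<le> 7"
proof -
  have "E d = E real - q * m / N" unfolding d_def by simp
  then show ?thesis using abs_E_d by simp
qed

text \<open>Recentring from \<open>q * m / N\<close> to the mean subtracts the square of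
  \<open>E d\<close>, at most 49; and 441 = 392 + 49.\<close>

lemma variance_asymp: "\<bar>measure_pmf.variance P real - 2 * (q * m)\<^sup>2 / N ^ 3\<bar> \<le> 441 * sqrt N"
proof -
  have Ed: "E d = E real - q * m / N" unfolding d_def by simp
  have "measure_pmf.variance P real = E (\<lambda>b. (d b)\<^sup>2 - 2 * E d * d b + (E d)\<^sup>2)"
  proof (intro Bochner_Integration.integral_cong refl)
    fix b have "real b - E real = d b - E d" unfolding Ed by (simp add: d_def)
    then show "(real b - E real)\<^sup>2 = (d b)\<^sup>2 - 2 * E d * d b + (E d)\<^sup>2"
      by (simp only: power2_diff) (simp only: power2_eq_square mult_ac)
  qed
  also have "\<dots> = E (\<lambda>b. (d b)\<^sup>2) - (E d)\<^sup>2"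
    by (simp add: power2_eq_square)
  finally have "measure_pmf.variance P real = E (\<lambda>b. (d b)\<^sup>2) - (E d)\<^sup>2" .
  moreover have "(E d)\<^sup>2 \<le> 7\<^sup>2" using abs_E_d by (intro abs_le_square_iff[THEN iffD1]) simp
  moreover have "(E d)\<^sup>2 \<ge> 0" by simp
  ultimately show ?thesis
    using E_square_asymp sqrt_N unfolding abs_le_iff power2_eq_square[of 7] by linarith
qed

text \<open>The first expectation is -i times the derivative of the characteristic function \<phi>
  of \<open>Z\<close>, so this is \<phi>' = - s \<rho> \<phi> up to an error. Here
  \<open>\<rho>\<close> is the leading variance divided by \<open>\<sigma>\<^sup>2\<close>, so
  \<open>\<sigma>\<close> may be any positive number. Half of the 14 is the remainder of
  \<open>stein\<close>, the other half the price of centring at the mean.\<close>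

lemma char_derivative_bound:
  fixes a \<sigma> s :: real
  assumes \<sigma>: "\<sigma> > 0" and a: "a = E real"
  defines "Z \<equiv> \<lambda>b. (real b - a) / \<sigma>" and "\<rho> \<equiv> 2 * (q * m)\<^sup>2 / (N ^ 3 * \<sigma>\<^sup>2)"
  shows "norm (E (\<lambda>b. of_real (Z b) * iexp (s * Z b)) - \<i> * of_real (s * \<rho>) * E (\<lambda>b. iexp (s * Z b)))
    \<le> 14 / \<sigma> + 2 * N * s\<^sup>2 / \<sigma> ^ 3 + 200 * \<bar>s\<bar> * sqrt N / \<sigma>\<^sup>2"
proof -
  define F where "F = (\<lambda>b. iexp (s * Z b))"
  define x where "x = 2 * s / \<sigma>"
  \<comment> \<open>\<open>K\<close> is the constant term of \<open>product_eq\<close>, at most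
    \<open>N\<^sup>2\<close>. \<open>R\<close> collects the fluctuations about it and is only O(N
    sqrt N), by the bounds on E |d| and E d^2.\<close>
  define K where "K = (q * m / N)\<^sup>2"
  define R where "R = E (\<lambda>b. of_real ((q - real b) * (m - real b) - K) * F b)"
  have nF: "norm (F b) = 1" for b by (simp add: F_def)
  have F2: "F (b + 2) - F b = F b * (iexp x - 1)" for b
  proof -
    have "s * Z (b + 2) = s * Z b + x"
      using \<sigma> by (simp add: Z_def x_def field_simps)
    then have "F (b + 2) = F b * iexp x"
      unfolding F_def by (simp add: distrib_left exp_add)
    then show ?thesis by (simp add: algebra_simps)
  qed
  have nE: "norm (E F) \<le> 1"
    using norm_E[of F] by (simp add: nF)
  have K: "0 \<le> K" "K \<le> N\<^sup>2"
  proof -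
    have "q * m \<le> N\<^sup>2" using N(4) zero_le_power2[of N] by linarith
    then have "q * m / N \<le> N"
      using N(2) by (simp add: field_simps power2_eq_square)
    then have "(q * m / N)\<^sup>2 \<le> N\<^sup>2"
      using N pos by (intro power_mono) auto
    then show "0 \<le> K" "K \<le> N\<^sup>2" by (auto simp: K_def)
  qed
  have "norm (of_real N * E (\<lambda>b. of_real (d b) * F b)
      - E (\<lambda>b. of_real ((q - real b) * (m - real b)) * (F (b + 2) - F b))) \<le> N * 7"
    using stein[of F] by (simp add: nF)
  also have "E (\<lambda>b. of_real ((q - real b) * (m - real b)) * (F (b + 2) - F b))
      = (iexp x - 1) * (of_real K * E F + R)"
  proof -
    have "of_real K * E F + R = E (\<lambda>b. of_real ((q - real b) * (m - real b)) * F b)"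
      unfolding R_def by (simp add: left_diff_distrib)
    then show ?thesis unfolding F2 by (simp add: mult.assoc[symmetric])
  qed
  finally have 1: "norm (of_real N * E (\<lambda>b. of_real (d b) * F b) - (iexp x - 1) * (of_real K * E F + R)) \<le> N * 7" .
  have "norm R \<le> E (\<lambda>b. norm (of_real ((q - real b) * (m - real b) - K) * F b))"
    unfolding R_def by (rule norm_E)
  also have "\<dots> \<le> E (\<lambda>b. N * \<bar>d b\<bar> + (d b)\<^sup>2)"
  proof (rule E_mono)
    fix b
    have "norm (of_real ((q - real b) * (m - real b) - K) * F b) = \<bar>(d b)\<^sup>2 - d b * ((q\<^sup>2 + m\<^sup>2) / N)\<bar>"
      by (simp only: norm_mult nF norm_of_real product_eq K_def) simp
    also have "\<dots> \<le> (d b)\<^sup>2 + \<bar>d b\<bar> * ((q\<^sup>2 + m\<^sup>2) / N)"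
      using N(2) by (intro order.trans[OF abs_triangle_ineq4]) (simp add: abs_mult)
    also have "\<dots> \<le> (d b)\<^sup>2 + \<bar>d b\<bar> * (N\<^sup>2 / N)"
      using N by (intro add_left_mono mult_left_mono divide_right_mono) auto
    finally show "norm (of_real ((q - real b) * (m - real b) - K) * F b) \<le> N * \<bar>d b\<bar> + (d b)\<^sup>2"
      using N(2) by (simp add: power2_eq_square mult.commute)
  qed
  also have "\<dots> = N * E (\<lambda>b. \<bar>d b\<bar>) + E (\<lambda>b. (d b)\<^sup>2)" by simp
  also have "\<dots> \<le> N * (34 * sqrt N) + 66 * N"
    using E_abs_le E_square_le N(2) by (intro add_mono mult_left_mono) auto
  also have "\<dots> \<le> 100 * (N * sqrt N)"
    using sqrt_N N(2) by (simp add: algebra_simps)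
  finally have R: "norm R \<le> 100 * (N * sqrt N)" .
  have e1: "norm (iexp x - 1) \<le> \<bar>x\<bar>" and e2: "norm (iexp x - 1 - \<i> * of_real x) \<le> x\<^sup>2 / 2"
    using iexp_approx1[of x 0] iexp_approx1[of x 1] by (simp_all add: power2_eq_square algebra_simps)
  have 2: "norm ((iexp x - 1) * (of_real K * E F + R) - \<i> * of_real (x * K) * E F) \<le> N\<^sup>2 * (x\<^sup>2 / 2) + \<bar>x\<bar> * (100 * (N * sqrt N))"
  proof -
    have "(iexp x - 1) * (of_real K * E F + R) - \<i> * of_real (x * K) * E F
        = of_real K * ((iexp x - 1 - \<i> * of_real x) * E F) + (iexp x - 1) * R"
      by (simp add: algebra_simps)
    also have "norm \<dots> \<le> K * (norm (iexp x - 1 - \<i> * of_real x) * norm (E F)) + norm (iexp x - 1) * norm R"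
      using norm_triangle_ineq[of "of_real K * ((iexp x - 1 - \<i> * of_real x) * E F)" "(iexp x - 1) * R"] K(1)
      by (simp only: norm_mult norm_of_real abs_of_nonneg)
    also have "\<dots> \<le> N\<^sup>2 * (x\<^sup>2 / 2 * 1) + \<bar>x\<bar> * (100 * (N * sqrt N))"
      using K e1 e2 nE R by (intro add_mono mult_mono) auto
    finally show ?thesis by simp
  qed
  have dZ: "of_real (d b) = of_real \<sigma> * of_real (Z b) + (of_real (E d) :: complex)" for b
  proof -
    have "E d = a - q * m / N" unfolding d_def a by simp
    then have "d b = \<sigma> * Z b + E d" using \<sigma> by (simp add: d_def Z_def)
    then show ?thesis by (metis of_real_add of_real_mult)
  qed
  have "E (\<lambda>b. of_real (d b) * F b) = of_real \<sigma> * E (\<lambda>b. of_real (Z b) * F b) + of_real (E d) * E F"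
    unfolding dZ by (simp add: distrib_right mult.assoc)
  \<comment> \<open>Three errors are separated: the remainder of \<open>stein\<close>, the
    linearisation of \<open>iexp x - 1\<close> together with \<open>R\<close>, and the shift of the
    centre by \<open>E d\<close>.\<close>
  then have eq: "of_real (N * \<sigma>) * (E (\<lambda>b. of_real (Z b) * F b) - \<i> * of_real (s * \<rho>) * E F)
      = of_real N * E (\<lambda>b. of_real (d b) * F b) - (iexp x - 1) * (of_real K * E F + R)
       + ((iexp x - 1) * (of_real K * E F + R) - \<i> * of_real (x * K) * E F) - of_real (N * E d) * E F"
  proof -
    have "N * \<sigma> * (s * \<rho>) = x * K"
      using \<sigma> N(2) by (simp add: \<rho>_def x_def K_def field_simps power2_eq_square power3_eq_cube)
    then have "of_real (N * \<sigma>) * (\<i> * of_real (s * \<rho>) * E F) = \<i> * of_real (x * K) * E F"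
      by (metis (no_types, lifting) mult.assoc mult.left_commute of_real_mult)
    then show ?thesis
      using \<open>E (\<lambda>b. of_real (d b) * F b) = _\<close> by (auto simp: algebra_simps)
  qed
  have 3: "norm (of_real (N * E d) * E F) \<le> N * 7"
  proof -
    have "norm (of_real (N * E d) * E F) = N * (\<bar>E d\<bar> * norm (E F))"
      using N(2) by (simp add: norm_mult abs_mult)
    also have "\<dots> \<le> N * (7 * 1)"
      using N(2) abs_E_d nE by (intro mult_left_mono mult_mono) auto
    finally show ?thesis by simp
  qed
  have "N * \<sigma> * norm (E (\<lambda>b. of_real (Z b) * F b) - \<i> * of_real (s * \<rho>) * E F)
      = norm (of_real (N * \<sigma>) * (E (\<lambda>b. of_real (Z b) * F b) - \<i> * of_real (s * \<rho>) * E F))"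
    using \<sigma> N(2) by (simp add: norm_mult)
  also have "\<dots> \<le> N * 7 + (N\<^sup>2 * (x\<^sup>2 / 2) + \<bar>x\<bar> * (100 * (N * sqrt N))) + N * 7"
    unfolding eq by (rule order.trans[OF norm_triangle_ineq4 add_mono[OF order.trans[OF norm_triangle_ineq add_mono[OF 1 2]] 3]])
  also have "\<dots> = N * \<sigma> * (14 / \<sigma> + 2 * N * s\<^sup>2 / \<sigma> ^ 3 + 200 * \<bar>s\<bar> * sqrt N / \<sigma>\<^sup>2)"
    using \<sigma> N(2) by (simp add: x_def abs_mult field_simps power2_eq_square power3_eq_cube)
  finally show ?thesis
    using \<sigma> N(2) unfolding F_def by simp
qed

text \<open>The limiting equation \<phi>' = - s \<phi> with \<phi>(0) = 1 is solved by exp(-s^2 /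
  2). The term with \<open>\<bar>1 - \<rho>\<bar>\<close> pays for replacing \<open>\<rho>\<close>
  by 1.\<close>

lemma char_bound:
  fixes a \<sigma> t :: real
  assumes \<sigma>: "\<sigma> > 0" and a: "a = E real"
  defines "Z \<equiv> \<lambda>b. (real b - a) / \<sigma>" and "\<rho> \<equiv> 2 * (q * m)\<^sup>2 / (N ^ 3 * \<sigma>\<^sup>2)"
  shows "norm (E (\<lambda>b. iexp (t * Z b)) - exp (- t\<^sup>2 / 2))
    \<le> \<bar>t\<bar> * (14 / \<sigma> + 2 * N * t\<^sup>2 / \<sigma> ^ 3 + 200 * \<bar>t\<bar> * sqrt N / \<sigma>\<^sup>2 + \<bar>t\<bar> * \<bar>1 - \<rho>\<bar>)"
proof -
  define \<delta> where "\<delta> = 14 / \<sigma> + 2 * N * t\<^sup>2 / \<sigma> ^ 3 + 200 * \<bar>t\<bar> * sqrt N / \<sigma>\<^sup>2 + \<bar>t\<bar> * \<bar>1 - \<rho>\<bar>"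
  define \<phi> where "\<phi> = (\<lambda>s. E (\<lambda>b. iexp (s * Z b)))"
  define \<phi>' where "\<phi>' = (\<lambda>s. \<i> * E (\<lambda>b. of_real (Z b) * iexp (s * Z b)))"
  \<comment> \<open>integrating factor of \<open>\<phi>' = - s \<phi>\<close>: the derivative of \<open>h\<close> is small\<close>
  define h where "h = (\<lambda>s. of_real (exp (s\<^sup>2 / 2)) * \<phi> s)"
  \<comment> \<open>The support is finite, so differentiation under the expectation is
    termwise.\<close>
  have E_sum: "E f = (\<Sum>b\<in>set_pmf P. pmf P b *\<^sub>R f b)" for f :: "nat \<Rightarrow> complex"
    by (rule integral_measure_pmf[OF fin])
  have d\<phi>: "(\<phi> has_vector_derivative \<phi>' s) (at s within S)" for s S
  proof -
    have "((\<lambda>s. iexp (s * Z b)) has_vector_derivative \<i> * of_real (Z b) * iexp (s * Z b)) (at s within S)" for b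
    proof -
      have "((\<lambda>z. exp (\<i> * of_real (Z b) * z)) has_field_derivative
          (\<i> * of_real (Z b)) * exp (\<i> * of_real (Z b) * of_real s)) (at (of_real s) within of_real ` S)"
        by (auto intro!: derivative_eq_intros)
      moreover have "(of_real has_vector_derivative (1 :: complex)) (at s within S)"
        using bounded_linear.has_vector_derivative[OF bounded_linear_of_real has_vector_derivative_id, of "at s within S"]
        by simp
      ultimately
      have "(((\<lambda>z. exp (\<i> * of_real (Z b) * z)) \<circ> of_real) has_vector_derivative
          1 * ((\<i> * of_real (Z b)) * exp (\<i> * of_real (Z b) * of_real s))) (at s within S)"
        by (intro field_vector_diff_chain_within)
      then show ?thesis by (simp add: o_def mult_ac)
    qed
    then show ?thesis
      unfolding \<phi>_def \<phi>'_def E_sum sum_distrib_left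
      by (auto intro!: derivative_eq_intros sum.cong simp: mult_ac)
  qed
  have dh: "(h has_vector_derivative of_real (exp (s\<^sup>2 / 2)) * (\<phi>' s + of_real s * \<phi> s)) (at s within S)" for s S
  proof -
    have "((\<lambda>s. exp (s\<^sup>2 / 2)) has_vector_derivative s * exp (s\<^sup>2 / 2)) (at s within S)"
      unfolding has_real_derivative_iff_has_vector_derivative[symmetric]
      by (auto intro!: derivative_eq_intros)
    then have "((\<lambda>s. of_real (exp (s\<^sup>2 / 2)) :: complex) has_vector_derivative of_real (s * exp (s\<^sup>2 / 2))) (at s within S)"
      by (rule bounded_linear.has_vector_derivative[OF bounded_linear_of_real])
    from has_vector_derivative_mult[OF this d\<phi>] show ?thesis
      unfolding h_def by (simp add: algebra_simps)
  qed
  have n\<phi>: "norm (\<phi> s) \<le> 1" for s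
    using norm_E[of "\<lambda>b. iexp (s * Z b)"] by (simp add: \<phi>_def)
  have bound: "norm (of_real (exp (s\<^sup>2 / 2)) * (\<phi>' s + of_real s * \<phi> s)) \<le> exp (t\<^sup>2 / 2) * \<delta>" if s: "\<bar>s\<bar> \<le> \<bar>t\<bar>" for s
  proof -
    have s2: "s\<^sup>2 \<le> t\<^sup>2" using s by (simp add: abs_le_square_iff)
    have "\<phi>' s + of_real s * \<phi> s = \<i> * (E (\<lambda>b. of_real (Z b) * iexp (s * Z b)) - \<i> * of_real (s * \<rho>) * \<phi> s)
        + of_real (s * (1 - \<rho>)) * \<phi> s"
      by (simp add: \<phi>'_def algebra_simps)
    also have "norm \<dots> \<le> norm (E (\<lambda>b. of_real (Z b) * iexp (s * Z b)) - \<i> * of_real (s * \<rho>) * \<phi> s)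
        + \<bar>s\<bar> * \<bar>1 - \<rho>\<bar> * norm (\<phi> s)"
      by (rule order.trans[OF norm_triangle_ineq]) (simp add: norm_mult abs_mult del: of_real_mult of_real_diff)
    also have "\<dots> \<le> (14 / \<sigma> + 2 * N * s\<^sup>2 / \<sigma> ^ 3 + 200 * \<bar>s\<bar> * sqrt N / \<sigma>\<^sup>2) + \<bar>s\<bar> * \<bar>1 - \<rho>\<bar> * 1"
    proof (intro add_mono mult_left_mono)
      show "norm (E (\<lambda>b. of_real (Z b) * iexp (s * Z b)) - \<i> * of_real (s * \<rho>) * \<phi> s)
          \<le> 14 / \<sigma> + 2 * N * s\<^sup>2 / \<sigma> ^ 3 + 200 * \<bar>s\<bar> * sqrt N / \<sigma>\<^sup>2"
        using char_derivative_bound[OF \<sigma> a, of s] unfolding \<phi>_def Z_def \<rho>_def .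
    qed (use n\<phi> in auto)
    \<comment> \<open>Every summand increases with \<open>\<bar>s\<bar>\<close>, and
      \<open>\<delta>\<close> is its value at \<open>\<bar>t\<bar>\<close>.\<close>
    also have "\<dots> \<le> \<delta>"
      unfolding \<delta>_def mult_1_right using s s2 \<sigma> N(2)
      by (intro add_mono divide_right_mono mult_mono order.refl) auto
    finally have "norm (\<phi>' s + of_real s * \<phi> s) \<le> \<delta>" .
    then show ?thesis
      unfolding norm_mult using s2 by (intro mult_mono) auto
  qed
  have "norm (h t - h 0) \<le> (exp (t\<^sup>2 / 2) * \<delta>) * norm (t - 0)"
  proof (rule differentiable_bound[where S = "{-\<bar>t\<bar>..\<bar>t\<bar>}" and f' = "\<lambda>s y. y *\<^sub>R (of_real (exp (s\<^sup>2 / 2)) * (\<phi>' s + of_real s * \<phi> s))"])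
    fix s assume "s \<in> {-\<bar>t\<bar>..\<bar>t\<bar>}"
    then have s: "\<bar>s\<bar> \<le> \<bar>t\<bar>" by auto
    show "(h has_derivative (\<lambda>y. y *\<^sub>R (of_real (exp (s\<^sup>2 / 2)) * (\<phi>' s + of_real s * \<phi> s)))) (at s within {-\<bar>t\<bar>..\<bar>t\<bar>})"
      using dh[of s "{-\<bar>t\<bar>..\<bar>t\<bar>}"] unfolding has_vector_derivative_def .
    show "onorm (\<lambda>y. y *\<^sub>R (of_real (exp (s\<^sup>2 / 2)) * (\<phi>' s + of_real s * \<phi> s))) \<le> exp (t\<^sup>2 / 2) * \<delta>"
    proof (rule onorm_le)
      fix y :: real
      show "norm (y *\<^sub>R (of_real (exp (s\<^sup>2 / 2)) * (\<phi>' s + of_real s * \<phi> s))) \<le> exp (t\<^sup>2 / 2) * \<delta> * norm y"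
        unfolding norm_scaleR real_norm_def mult.commute[of _ "\<bar>y\<bar>"] by (intro mult_left_mono bound[OF s]) simp
    qed
  qed auto
  also have "h 0 = 1" by (simp add: h_def \<phi>_def)
  finally have 1: "norm (h t - 1) \<le> exp (t\<^sup>2 / 2) * (\<bar>t\<bar> * \<delta>)" by (simp add: mult_ac)
  \<comment> \<open>The factor \<open>exp (t\<^sup>2 / 2)\<close> that bounds the derivative on the
    whole interval is also the factor in front of \<open>\<phi> t\<close>, so it cancels and the
    final bound has no exponential.\<close>
  have "h t - 1 = of_real (exp (t\<^sup>2 / 2)) * (\<phi> t - of_real (exp (- t\<^sup>2 / 2)))"
    unfolding h_def right_diff_distrib of_real_mult[symmetric] exp_add[symmetric] by simp
  then have "norm (h t - 1) = exp (t\<^sup>2 / 2) * norm (\<phi> t - of_real (exp (- t\<^sup>2 / 2)))"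
    by (simp only: norm_mult norm_of_real abs_exp_cancel)
  with 1 show ?thesis by (simp add: \<phi>_def \<delta>_def exp_of_real[symmetric])
qed

end

section \<open>Asymptotic normality\<close>

lemma switching_pmf_bridge_pmf:
  assumes "sized_bubbles n q \<noteq> {}" "1 \<le> q" "q \<le> 2 * int n - 1"
  shows "switching_pmf (bridge_pmf n q) (real_of_int q) (2 * real n - real_of_int q)"
proof
  have q: "1 \<le> real_of_int q" "real_of_int q \<le> 2 * real n - 1"
    using assms(2,3) by linarith+
  show "finite (set_pmf (bridge_pmf n q))" by (rule finite_bridge_pmf[OF assms(1)])
  show "real_of_int q > 0" "2 * real n - real_of_int q > 0"
    "real_of_int q + (2 * real n - real_of_int q) \<ge> 1" using q by linarith+
  show "real b \<le> real_of_int q" "real b \<le> 2 * real n - real_of_int q"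
    if "b \<in> set_pmf (bridge_pmf n q)" for b
    using bridge_pmf_le[OF assms(1) that] .
  show "norm (measure_pmf.expectation (bridge_pmf n q) (\<lambda>b. of_real ((real b)\<^sup>2) * F b
        - of_real ((real_of_int q - real b) * (2 * real n - real_of_int q - real b)) * F (b + 2)))
      \<le> measure_pmf.expectation (bridge_pmf n q)
          (\<lambda>b. 3 * real_of_int q * norm (F b) + 4 * real_of_int q * norm (F (b + 2)))"
    for F :: "nat \<Rightarrow> complex"
    using expectation_switching[OF assms(1), of F] unfolding scaleR_conv_of_real .
qed

lemma char_distr_measure_pmf:
  "char (distr (measure_pmf P) borel g) t = measure_pmf.expectation P (\<lambda>b. iexp (t * g b))"
  unfolding char_def by (subst integral_distr) auto

lemma real_distribution_distr_measure_pmf: "real_distribution (distr (measure_pmf P) borel g)"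
  by (intro prob_space.real_distribution_distr measure_pmf.prob_space_axioms) simp

theorem mainTheorem2:
  fixes q :: "nat \<Rightarrow> int" and c :: real
  assumes "0 < c" and "c < 2"
    and "(\<lambda>n. real_of_int (q n) / real n) \<longlonglongrightarrow> c"
  defines "\<mu> \<equiv> \<lambda>n. measure_pmf.expectation (bridge_pmf n (q n)) real"
    and "V \<equiv> \<lambda>n. measure_pmf.variance (bridge_pmf n (q n)) real"
  shows "((\<lambda>n. \<mu> n / (real_of_int (q n) * (2 * (real n - 1) - real_of_int (q n))
              / (2 * (real n - 1)))) \<longlonglongrightarrow> 1)
    \<and> ((\<lambda>n. V n / ((real_of_int (q n))\<^sup>2 * (2 * (real n - 1) - real_of_int (q n))\<^sup>2
              / (4 * (real n - 1) ^ 3))) \<longlonglongrightarrow> 1)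
    \<and> weak_conv_m (\<lambda>n. distr (measure_pmf (bridge_pmf n (q n))) borel
              (\<lambda>b. (real b - \<mu> n) / sqrt (V n))) std_normal_distribution"
proof -
  \<comment> \<open>Quantities of order n are divided by n. \<open>\<alpha>\<close> and
    \<open>\<beta>\<close> are the limits of \<open>\<mu> n / n\<close> and \<open>V n / n\<close>,
    nonzero because 0 < c < 2; \<open>z\<close> compares n - 1 with n.\<close>
  define x where "x = (\<lambda>n. real_of_int (q n) / real n)"
  define w where "w = (\<lambda>n. V n / real n)"
  define z where "z = (\<lambda>n. (real n - 1) / real n)"
  define \<alpha> where "\<alpha> = c * (2 - c) / 2"
  define \<beta> where "\<beta> = (c * (2 - c))\<^sup>2 / 4"
  have \<alpha>: "\<alpha> \<noteq> 0" and \<beta>: "\<beta> > 0" using assms(1,2) by (auto simp: \<alpha>_def \<beta>_def)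
  have x: "x \<longlonglongrightarrow> c" using assms(3) by (simp add: x_def)
  have z: "z \<longlonglongrightarrow> 1" unfolding z_def by real_asymp
  \<comment> \<open>(c + 2) / 2 is the midpoint of c and 2, so at least (2 - c) / 2 * n vertices,
    eventually two or more, remain outside the bubble: room for the short chord in
    \<open>sized_bubbles_nonempty\<close>.\<close>
  have "\<forall>\<^sub>F n in sequentially. x n > c / 2" "\<forall>\<^sub>F n in sequentially. x n < (c + 2) / 2"
    using assms(1,2) order_tendstoD(1)[OF x, of "c / 2"] order_tendstoD(2)[OF x, of "(c + 2) / 2"] by simp_all
  moreover have "\<forall>\<^sub>F n in sequentially. c / 2 * real n \<ge> 1"
    "\<forall>\<^sub>F n in sequentially. (2 - c) / 2 * real n \<ge> 2" "\<forall>\<^sub>F n in sequentially. n \<ge> 3"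
    using assms(1,2) by real_asymp+
  ultimately have ev: "\<forall>\<^sub>F n in sequentially. n \<ge> 3 \<and>
      switching_pmf (bridge_pmf n (q n)) (real_of_int (q n)) (2 * real n - real_of_int (q n))"
  proof eventually_elim
    case (elim n)
    then have "real_of_int (q n) > c / 2 * real n" "real_of_int (q n) < (c + 2) / 2 * real n"
      by (simp_all add: x_def field_simps)
    moreover have "(c + 2) / 2 * real n = 2 * real n - (2 - c) / 2 * real n"
      by (simp add: field_simps)
    ultimately have "real_of_int (q n) \<ge> 1" "real_of_int (q n) \<le> 2 * real n - 2"
      using elim by linarith+
    then have "1 \<le> q n" "q n \<le> 2 * int n - 2" by linarith+
    then show ?case
      using elim sized_bubbles_nonempty by (auto intro!: switching_pmf_bridge_pmf)
  qed
  have \<mu>: "(\<lambda>n. \<mu> n / real n) \<longlonglongrightarrow> \<alpha>"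
  proof (rule Lim_transform)
    show "(\<lambda>n. x n * (2 - x n) / 2) \<longlonglongrightarrow> \<alpha>"
      unfolding \<alpha>_def by (intro tendsto_intros x) simp
    show "(\<lambda>n. \<mu> n / real n - x n * (2 - x n) / 2) \<longlonglongrightarrow> 0"
    proof (rule Lim_null_comparison)
      show "(\<lambda>n. 7 / real n) \<longlonglongrightarrow> 0" by real_asymp
      show "\<forall>\<^sub>F n in sequentially. norm (\<mu> n / real n - x n * (2 - x n) / 2) \<le> 7 / real n"
        using ev
      proof eventually_elim
        case (elim n)
        then interpret switching_pmf "bridge_pmf n (q n)" "real_of_int (q n)" "2 * real n - real_of_int (q n)"
          by blast
        have NN: "N = 2 * real n" by (simp add: N_def)
        have "\<mu> n / real n - x n * (2 - x n) / 2 =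
            (\<mu> n - real_of_int (q n) * (2 * real n - real_of_int (q n)) / (2 * real n)) / real n"
          using elim by (simp add: x_def field_simps)
        then show ?case
          using mean_asymp elim unfolding NN \<mu>_def by (simp add: divide_right_mono)
      qed
    qed
  qed
  have w: "w \<longlonglongrightarrow> \<beta>"
  proof (rule Lim_transform)
    show "(\<lambda>n. (x n * (2 - x n))\<^sup>2 / 4) \<longlonglongrightarrow> \<beta>"
      unfolding \<beta>_def by (intro tendsto_intros x) simp
    show "(\<lambda>n. w n - (x n * (2 - x n))\<^sup>2 / 4) \<longlonglongrightarrow> 0"
    proof (rule Lim_null_comparison)
      show "(\<lambda>n. 441 * sqrt (2 * real n) / real n) \<longlonglongrightarrow> 0" by real_asymp
      show "\<forall>\<^sub>F n in sequentially. norm (w n - (x n * (2 - x n))\<^sup>2 / 4) \<le> 441 * sqrt (2 * real n) / real n"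
        using ev
      proof eventually_elim
        case (elim n)
        then interpret switching_pmf "bridge_pmf n (q n)" "real_of_int (q n)" "2 * real n - real_of_int (q n)"
          by blast
        have NN: "N = 2 * real n" by (simp add: N_def)
        have "w n - (x n * (2 - x n))\<^sup>2 / 4 =
            (V n - 2 * (real_of_int (q n) * (2 * real n - real_of_int (q n)))\<^sup>2 / (2 * real n) ^ 3) / real n"
          using elim by (simp add: x_def w_def field_simps power2_eq_square power3_eq_cube)
        then show ?case
          using variance_asymp elim unfolding NN V_def by (simp add: divide_right_mono)
      qed
    qed
  qed
  have 1: "(\<lambda>n. \<mu> n / (real_of_int (q n) * (2 * (real n - 1) - real_of_int (q n)) / (2 * (real n - 1)))) \<longlonglongrightarrow> 1"
  proof (rule Lim_transform_eventually)
    have "(\<lambda>n. (\<mu> n / real n) / (x n * (2 * z n - x n) / (2 * z n))) \<longlonglongrightarrow> \<alpha> / (c * (2 * 1 - c) / (2 * 1))"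
      using \<alpha> by (intro tendsto_intros \<mu> x z) (auto simp: \<alpha>_def)
    then show "(\<lambda>n. (\<mu> n / real n) / (x n * (2 * z n - x n) / (2 * z n))) \<longlonglongrightarrow> 1"
      using \<alpha> by (simp add: \<alpha>_def)
    show "\<forall>\<^sub>F n in sequentially. (\<mu> n / real n) / (x n * (2 * z n - x n) / (2 * z n)) =
        \<mu> n / (real_of_int (q n) * (2 * (real n - 1) - real_of_int (q n)) / (2 * (real n - 1)))"
      using ev
    proof eventually_elim
      case (elim n)
      then have "x n * (2 * z n - x n) / (2 * z n) =
          real_of_int (q n) * (2 * (real n - 1) - real_of_int (q n)) / (2 * (real n - 1)) / real n"
        by (simp add: x_def z_def field_simps)
      then show ?case using elim by simp
    qed
  qed
  have 2: "(\<lambda>n. V n / ((real_of_int (q n))\<^sup>2 * (2 * (real n - 1) - real_of_int (q n))\<^sup>2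
      / (4 * (real n - 1) ^ 3))) \<longlonglongrightarrow> 1"
  proof (rule Lim_transform_eventually)
    have "(\<lambda>n. w n / ((x n)\<^sup>2 * (2 * z n - x n)\<^sup>2 / (4 * z n ^ 3))) \<longlonglongrightarrow> \<beta> / (c\<^sup>2 * (2 * 1 - c)\<^sup>2 / (4 * 1 ^ 3))"
      using \<beta> by (intro tendsto_intros w x z) (auto simp: \<beta>_def)
    moreover have "\<beta> / (c\<^sup>2 * (2 * 1 - c)\<^sup>2 / (4 * 1 ^ 3)) = 1"
      using assms(1,2) by (simp add: \<beta>_def power_mult_distrib)
    ultimately show "(\<lambda>n. w n / ((x n)\<^sup>2 * (2 * z n - x n)\<^sup>2 / (4 * z n ^ 3))) \<longlonglongrightarrow> 1"
      by (simp only:)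
    show "\<forall>\<^sub>F n in sequentially. w n / ((x n)\<^sup>2 * (2 * z n - x n)\<^sup>2 / (4 * z n ^ 3)) =
        V n / ((real_of_int (q n))\<^sup>2 * (2 * (real n - 1) - real_of_int (q n))\<^sup>2 / (4 * (real n - 1) ^ 3))"
      using ev
    proof eventually_elim
      case (elim n)
      have "2 * z n - x n = (2 * (real n - 1) - real_of_int (q n)) / real n"
        by (simp add: x_def z_def diff_divide_distrib)
      then have "(x n)\<^sup>2 * (2 * z n - x n)\<^sup>2 / (4 * z n ^ 3) =
          (real_of_int (q n))\<^sup>2 * (2 * (real n - 1) - real_of_int (q n))\<^sup>2 / (4 * (real n - 1) ^ 3) / real n"
        using elim by (simp add: x_def z_def power_divide power2_eq_square power3_eq_cube mult_ac)
      then show ?case using elim by (simp add: w_def)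
    qed
  qed
  have 3: "weak_conv_m (\<lambda>n. distr (measure_pmf (bridge_pmf n (q n))) borel
      (\<lambda>b. (real b - \<mu> n) / sqrt (V n))) std_normal_distribution"
  proof (rule levy_continuity[OF real_distribution_distr_measure_pmf real_dist_normal_dist])
    fix t :: real
    \<comment> \<open>This is the bound of \<open>char_bound\<close> with \<open>\<sigma>\<close> =
      sqrt (w n) sqrt n. Three terms decay like 1 / sqrt n; the last vanishes because
      \<open>w\<close> and the leading variance over n share the limit
      \<open>\<beta>\<close>.\<close>
    let ?bound = "\<lambda>n. \<bar>t\<bar> * (14 / (sqrt (w n) * sqrt (real n)) + 4 * t\<^sup>2 / (sqrt (w n) ^ 3 * sqrt (real n))
      + 200 * \<bar>t\<bar> * sqrt 2 / (w n * sqrt (real n)) + \<bar>t\<bar> * \<bar>1 - (x n * (2 - x n))\<^sup>2 / 4 / w n\<bar>)"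
    have i: "(\<lambda>n. 1 / sqrt (real n)) \<longlonglongrightarrow> 0" by real_asymp
    have "(\<lambda>n. \<bar>t\<bar> * (14 / sqrt (w n) * (1 / sqrt (real n)) + 4 * t\<^sup>2 / sqrt (w n) ^ 3 * (1 / sqrt (real n))
        + 200 * \<bar>t\<bar> * sqrt 2 / w n * (1 / sqrt (real n)) + \<bar>t\<bar> * \<bar>1 - (x n * (2 - x n))\<^sup>2 / 4 / w n\<bar>))
      \<longlonglongrightarrow> \<bar>t\<bar> * (14 / sqrt \<beta> * 0 + 4 * t\<^sup>2 / sqrt \<beta> ^ 3 * 0
        + 200 * \<bar>t\<bar> * sqrt 2 / \<beta> * 0 + \<bar>t\<bar> * \<bar>1 - (c * (2 - c))\<^sup>2 / 4 / \<beta>\<bar>)"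
      using \<beta> by (intro tendsto_intros w x i) auto
    then have bound: "?bound \<longlonglongrightarrow> 0"
      using \<beta> by (simp add: \<beta>_def)
    have "\<forall>\<^sub>F n in sequentially. w n > 0"
      using order_tendstoD(1)[OF w \<beta>] .
    with ev have "\<forall>\<^sub>F n in sequentially. norm (char (distr (measure_pmf (bridge_pmf n (q n))) borel
        (\<lambda>b. (real b - \<mu> n) / sqrt (V n))) t - char std_normal_distribution t) \<le> ?bound n"
    proof eventually_elim
      case (elim n)
      then interpret switching_pmf "bridge_pmf n (q n)" "real_of_int (q n)" "2 * real n - real_of_int (q n)"
        by blast
      \<comment> \<open>With these roots the standard deviation is \<open>u * r\<close> and every
        power of n becomes a power of \<open>r\<close>, so that the comparison of bounds is rational
        apart from \<open>sqrt 2\<close>.\<close>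
      define r u where "r = sqrt (real n)" and "u = sqrt (w n)"
      have r: "r > 0" "real n = r\<^sup>2" and u: "u > 0" "w n = u\<^sup>2"
        using elim by (auto simp: r_def u_def)
      have V: "sqrt (V n) = u * r"
        using elim by (simp add: u_def r_def w_def real_sqrt_mult[symmetric])
      have NN: "N = 2 * r\<^sup>2" unfolding N_def r(2)[symmetric] by simp
      have sN: "sqrt N = sqrt 2 * r" using r(1) by (simp add: NN real_sqrt_mult)
      have q: "real_of_int (q n) = x n * r\<^sup>2" using r by (simp add: x_def)
      have "u * r > 0" "\<mu> n = E real" using u r by (simp_all add: \<mu>_def)
      from char_bound[OF this, of t]
      have "norm (E (\<lambda>b. iexp (t * ((real b - \<mu> n) / (u * r)))) - exp (- t\<^sup>2 / 2)) \<le>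
        \<bar>t\<bar> * (14 / (u * r) + 2 * (2 * r\<^sup>2) * t\<^sup>2 / (u * r) ^ 3 + 200 * \<bar>t\<bar> * (sqrt 2 * r) / (u * r)\<^sup>2
          + \<bar>t\<bar> * \<bar>1 - 2 * (x n * r\<^sup>2 * (2 * r\<^sup>2 - x n * r\<^sup>2))\<^sup>2 / ((2 * r\<^sup>2) ^ 3 * (u * r)\<^sup>2)\<bar>)"
        unfolding sN unfolding NN unfolding q r(2) .
      moreover have "2 * (2 * r\<^sup>2) * t\<^sup>2 / (u * r) ^ 3 = 4 * t\<^sup>2 / (u ^ 3 * r)"
        "200 * \<bar>t\<bar> * (sqrt 2 * r) / (u * r)\<^sup>2 = 200 * \<bar>t\<bar> * sqrt 2 / (u\<^sup>2 * r)"
        using u(1) r(1) by (simp_all add: field_simps power2_eq_square power3_eq_cube)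
      moreover have "2 * (x n * r\<^sup>2 * (2 * r\<^sup>2 - x n * r\<^sup>2))\<^sup>2 / ((2 * r\<^sup>2) ^ 3 * (u * r)\<^sup>2)
          = (x n * (2 - x n))\<^sup>2 / 4 / u\<^sup>2"
      proof -
        have "x n * r\<^sup>2 * (2 * r\<^sup>2 - x n * r\<^sup>2) = (x n * (2 - x n)) * r ^ 4"
          by (simp add: algebra_simps power2_eq_square power4_eq_xxxx)
        moreover have "2 * (y * r ^ 4)\<^sup>2 / ((2 * r\<^sup>2) ^ 3 * (u * r)\<^sup>2) = y\<^sup>2 / 4 / u\<^sup>2" for y
          using u(1) r(1) by (simp add: field_simps power2_eq_square power3_eq_cube power4_eq_xxxx)
        ultimately show ?thesis by (simp only:)
      qed
      ultimately show ?case
        unfolding char_distr_measure_pmf char_std_normal_distribution V r_def[symmetric] u_def[symmetric]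
        unfolding u(2) by (simp only:)
    qed
    then have "(\<lambda>n. char (distr (measure_pmf (bridge_pmf n (q n))) borel
        (\<lambda>b. (real b - \<mu> n) / sqrt (V n))) t - char std_normal_distribution t) \<longlonglongrightarrow> 0"
      by (rule Lim_null_comparison[OF _ bound])
    then show "(\<lambda>n. char (distr (measure_pmf (bridge_pmf n (q n))) borel
        (\<lambda>b. (real b - \<mu> n) / sqrt (V n))) t) \<longlonglongrightarrow> char std_normal_distribution t"
      by (rule LIM_zero_cancel)
  qed
  show ?thesis using 1 2 3 by blast
qed

end
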